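(* Let $P$, $M$, $N$ be smooth manifolds, let $Z$ be a smooth vector field on $P$, and let $\overline{\alpha}\colon M\times N\to P$ be a diffeomorphism. Then $\overline{\alpha}$ is a complete slicing for $Z$ if and only if the map $F=\mathrm{pr}_2\circ\overline{\alpha}^{-1}\colon P\to N$ is a constant of the motion for $Z$, where $\mathrm{pr}_2\colon M\times N\to N$ is the projection onto the second factor.
   Context: All manifolds and maps are $C^\infty$. A dynamical system is a pair $(P,Z)$ of a manifold $P$ and a vector field $Z$ on $P$. A slicing of $(P,Z)$ is a triple $(M,\alpha,X)$, where $M$ is a manifold, $\alpha\colon M\to P$ a map and $X$ a vector field on $M$, satisfying the slicing equation $T\alpha\circ X=Z\circ\alpha$. A complete slicing of $(P,Z)$ is given by a map $\overline{\alpha}\colon M\times N\to P$ and a vector field $\overline{X}\colon M\times N\to TM$ along the projection $M\times N\to M$ (i.e. smooth families of maps $\alpha_c=\overline{\alpha}(\cdot,c)\colon M\to P$ and vector fields $X_c=\overline{X}(\cdot,c)$ on $M$, indexed by $c\in N$) such that $\overline{\alpha}$ is surjective (or at least its image is an open dense subset of $P$) and, for each $c\in N$, $(M,\alpha_c,X_c)$ is a slicing of $(P,Z)$. When each $\alpha_c$ is an immersion (in particular when $\overline{\alpha}$ is a diffeomorphism) the $X_c$ are determined by the $\alpha_c$, and one says that $\overline{\alpha}$ is a complete slicing if such an $\overline{X}$ exists. A (manifold-valued) constant of the motion for $Z$ is a map $F\colon P\to N$ such that $F\circ\zeta$ is constant for every integral curve $\zeta\colon I\to P$ of $Z$ ($I\subset\mathbb{R}$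 an open interval). *)

theory Defs
  imports "HOL-Analysis.Analysis"
begin

section \<open>Model spaces\<close>

text \<open>The class \<open>euclidean_space\<close> requires a nonempty basis. Manifolds may have dimension 0, so
  the model spaces are taken from the following class, which drops that requirement.\<close>

class finite_dim_inner = real_inner +
  assumes finite_dim_sum: "\<exists>B. finite B \<and> (\<forall>x. \<exists>u. x = (\<Sum>b\<in>B. u b *\<^sub>R b))"

subclass (in euclidean_space) finite_dim_inner
  by standard (metis finite_Basis euclidean_representation)

lemma finite_dim: "\<exists>B :: 'a::finite_dim_inner set. finite B \<and> span B = UNIV"
proof -
  obtain B :: "'a set" where B: "finite B" "\<And>x. \<exists>u. x = (\<Sum>b\<in>B. u b *\<^sub>R b)"
    using finite_dim_sum by blast
  have "x \<in> span B" for x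
    using B by (metis (no_types, lifting) span_base span_scale span_sum)
  then show ?thesis using B by auto
qed

instance prod :: (finite_dim_inner, finite_dim_inner) finite_dim_inner
proof
  obtain B :: "'a set" where B: "finite B" "span B = UNIV" using finite_dim by blast
  obtain C :: "'b set" where C: "finite C" "span C = UNIV" using finite_dim by blast
  let ?D = "(\<lambda>x. (x, 0)) ` B \<union> (\<lambda>y. (0, y)) ` C :: ('a \<times> 'b) set"
  have lin: "linear (\<lambda>x. (x, 0) :: 'a \<times> 'b)" "linear (\<lambda>y. (0, y) :: 'a \<times> 'b)"
    by (auto intro!: linearI)
  have "(x, y) \<in> span ?D" for x :: 'a and y :: 'b
  proof -
    have "(x, 0) \<in> span ?D" "(0, y) \<in> span ?D"
      using linear_span_image[OF lin(1), of B] linear_span_image[OF lin(2), of C] B C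
        span_mono[of "(\<lambda>x. (x, 0)) ` B" ?D] span_mono[of "(\<lambda>y. (0, y)) ` C" ?D] by auto
    then have "(x, 0) + (0, y) \<in> span ?D" by (rule span_add)
    then show ?thesis by simp
  qed
  moreover have "finite ?D" using B C by simp
  ultimately show "\<exists>D :: ('a \<times> 'b) set. finite D \<and> (\<forall>x. \<exists>u. x = (\<Sum>b\<in>D. u b *\<^sub>R b))"
    by (intro exI[of _ ?D]) (auto simp: span_finite)
qed

text \<open>The type \<open>unit\<close> as the model space of dimension 0.\<close>

instantiation unit :: real_inner
begin

definition zero_unit :: unit where "zero_unit = ()"
definition plus_unit :: "unit \<Rightarrow> unit \<Rightarrow> unit" where "plus_unit x y = ()"
definition minus_unit :: "unit \<Rightarrow> unit \<Rightarrow> unit" where "minus_unit x y = ()"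
definition uminus_unit :: "unit \<Rightarrow> unit" where "uminus_unit x = ()"
definition scaleR_unit :: "real \<Rightarrow> unit \<Rightarrow> unit" where "scaleR_unit r x = ()"
definition sgn_unit :: "unit \<Rightarrow> unit" where "sgn_unit x = ()"
definition norm_unit :: "unit \<Rightarrow> real" where "norm_unit x = 0"
definition inner_unit :: "unit \<Rightarrow> unit \<Rightarrow> real" where "inner_unit x y = 0"
definition dist_unit :: "unit \<Rightarrow> unit \<Rightarrow> real" where "dist_unit x y = 0"
definition uniformity_unit :: "(unit \<times> unit) filter" where
  "uniformity_unit = (INF e\<in>{0<..}. principal {(x, y). dist x y < e})"
definition open_unit :: "unit set \<Rightarrow> bool" where
  "open_unit U \<longleftrightarrow> (\<forall>x\<in>U. \<forall>\<^sub>F (x', y) in uniformity. x' = x \<longrightarrow> y \<in> U)"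

instance
  by standard (simp_all add: norm_unit_def inner_unit_def dist_unit_def uniformity_unit_def
      open_unit_def)

end

instance unit :: finite_dim_inner
  by standard (auto intro!: exI[of _ UNIV])

section \<open>Smooth maps between model spaces\<close>

text \<open>Intended for open \<open>S\<close>. As the model spaces are finite-dimensional, continuity of all
  iterated directional derivatives is continuity of the iterated Frechet derivatives.\<close>

primrec Ck_on :: "nat \<Rightarrow> 'e::real_normed_vector set \<Rightarrow> ('e \<Rightarrow> 'f::real_normed_vector) \<Rightarrow> bool" where
  "Ck_on 0 S f \<longleftrightarrow> continuous_on S f"
| "Ck_on (Suc k) S f \<longleftrightarrow>
    (\<forall>x\<in>S. f differentiable (at x)) \<and> (\<forall>v. Ck_on k S (\<lambda>x. frechet_derivative f (at x) v))"

definition smooth_on :: "'e::real_normed_vector set \<Rightarrow> ('e \<Rightarrow> 'f::real_normed_vector) \<Rightarrow> bool" where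
  "smooth_on S f \<longleftrightarrow> (\<forall>k. Ck_on k S f)"

section \<open>Smooth manifolds\<close>

text \<open>A chart is a domain together with a map that is only relevant on this domain. The smooth
  structure is given by an atlas that need not be maximal.\<close>

type_synonym ('a, 'e) chart = "'a set \<times> ('a \<Rightarrow> 'e)"

record ('a, 'e) manifold =
  mtop :: "'a topology"
  atlas :: "('a, 'e) chart set"

abbreviation points :: "('a, 'e) manifold \<Rightarrow> 'a set" where
  "points M \<equiv> topspace (mtop M)"

definition charts_at :: "('a, 'e) manifold \<Rightarrow> 'a \<Rightarrow> ('a, 'e) chart set" where
  "charts_at M p = {c \<in> atlas M. p \<in> fst c}"

definition local_rep :: "('a, 'e) chart \<Rightarrow> ('b, 'f) chart \<Rightarrow> ('a \<Rightarrow> 'b) \<Rightarrow> 'e \<Rightarrow> 'f" where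
  "local_rep c d f = snd d \<circ> f \<circ> inv_into (fst c) (snd c)"

definition smooth_manifold :: "('a, 'e::finite_dim_inner) manifold \<Rightarrow> bool" where
  "smooth_manifold M \<longleftrightarrow>
    Hausdorff_space (mtop M) \<and> second_countable (mtop M) \<and>
    (\<Union>c\<in>atlas M. fst c) = points M \<and>
    (\<forall>(U, \<phi>)\<in>atlas M. openin (mtop M) U \<and> open (\<phi> ` U) \<and>
      homeomorphic_map (subtopology (mtop M) U) (top_of_set (\<phi> ` U)) \<phi>) \<and>
    (\<forall>c\<in>atlas M. \<forall>d\<in>atlas M. smooth_on (snd c ` (fst c \<inter> fst d)) (local_rep c d (\<lambda>x. x)))"

definition smooth_map ::
    "('a, 'e::finite_dim_inner) manifold \<Rightarrow> ('b, 'f::finite_dim_inner) manifold \<Rightarrow> ('a \<Rightarrow> 'b) \<Rightarrow> bool"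
  where "smooth_map M N f \<longleftrightarrow> continuous_map (mtop M) (mtop N) f \<and>
    (\<forall>c\<in>atlas M. \<forall>d\<in>atlas N. smooth_on (snd c ` {x \<in> fst c. f x \<in> fst d}) (local_rep c d f))"

definition diffeomorphism ::
    "('a, 'e::finite_dim_inner) manifold \<Rightarrow> ('b, 'f::finite_dim_inner) manifold \<Rightarrow> ('a \<Rightarrow> 'b) \<Rightarrow> bool"
  where "diffeomorphism M N f \<longleftrightarrow> bij_betw f (points M) (points N) \<and>
    smooth_map M N f \<and> smooth_map N M (inv_into (points M) f)"

definition prod_manifold ::
    "('a, 'e) manifold \<Rightarrow> ('b, 'f) manifold \<Rightarrow> ('a \<times> 'b, 'e \<times> 'f) manifold" where
  "prod_manifold M N = \<lparr>mtop = prod_topology (mtop M) (mtop N),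
    atlas = {(fst c \<times> fst d, map_prod (snd c) (snd d)) |c d. c \<in> atlas M \<and> d \<in> atlas N}\<rparr>"

section \<open>Tangent bundles\<close>

text \<open>A tangent vector at \<open>p\<close> is the pair of \<open>p\<close> and the family of its principal parts in the
  charts around \<open>p\<close>, which are related by the derivatives of the chart changes. The family is set
  to 0 at all other arguments, so that equality of tangent vectors is equality in HOL.\<close>

type_synonym ('a, 'e) tangent = "'a \<times> (('a, 'e) chart \<Rightarrow> 'e)"

definition tangent_space ::
    "('a, 'e::finite_dim_inner) manifold \<Rightarrow> 'a \<Rightarrow> ('a, 'e) tangent set" where
  "tangent_space M p = {(p, \<xi>) |\<xi>.
    (\<forall>c\<in>charts_at M p. \<forall>d\<in>charts_at M p.
      \<xi> d = frechet_derivative (local_rep c d (\<lambda>x. x)) (at (snd c p)) (\<xi> c)) \<and>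
    (\<forall>c. c \<notin> charts_at M p \<longrightarrow> \<xi> c = 0)}"

definition tangent_chart ::
    "('a, 'e::finite_dim_inner) manifold \<Rightarrow> ('a, 'e) chart \<Rightarrow> (('a, 'e) tangent, 'e \<times> 'e) chart" where
  "tangent_chart M c = (\<Union>p\<in>fst c. tangent_space M p, \<lambda>v. (snd c (fst v), snd v c))"

definition tangent_bundle ::
    "('a, 'e::finite_dim_inner) manifold \<Rightarrow> (('a, 'e) tangent, 'e \<times> 'e) manifold" where
  "tangent_bundle M = \<lparr>mtop = topology_generated_by
      {fst (tangent_chart M c) \<inter> snd (tangent_chart M c) -` W |c W. c \<in> atlas M \<and> open W},
    atlas = tangent_chart M ` atlas M\<rparr>"

text \<open>By the chain rule the result does not depend on the chart chosen around the foot point.\<close>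

definition tangent_map ::
    "('a, 'e::finite_dim_inner) manifold \<Rightarrow> ('b, 'f::finite_dim_inner) manifold \<Rightarrow> ('a \<Rightarrow> 'b) \<Rightarrow>
      ('a, 'e) tangent \<Rightarrow> ('b, 'f) tangent" where
  "tangent_map M N f v = (let p = fst v; c = (SOME c. c \<in> charts_at M p) in
    (f p, \<lambda>d. if d \<in> charts_at N (f p)
      then frechet_derivative (local_rep c d f) (at (snd c p)) (snd v c) else 0))"

definition vector_field ::
    "('a, 'e::finite_dim_inner) manifold \<Rightarrow> ('a \<Rightarrow> ('a, 'e) tangent) \<Rightarrow> bool" where
  "vector_field M X \<longleftrightarrow> smooth_map M (tangent_bundle M) X \<and> (\<forall>p\<in>points M. fst (X p) = p)"

section \<open>Integral curves and constants of the motion\<close>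

definition interval_manifold :: "real set \<Rightarrow> (real, real) manifold" where
  "interval_manifold I = \<lparr>mtop = top_of_set I, atlas = {(I, \<lambda>t. t)}\<rparr>"

text \<open>The standard vector field \<open>d/dt\<close> on an open interval.\<close>

definition unit_field :: "real set \<Rightarrow> real \<Rightarrow> (real, real) tangent" where
  "unit_field I t = (t, \<lambda>c. if c \<in> charts_at (interval_manifold I) t then 1 else 0)"

definition integral_curve ::
    "('a, 'e::finite_dim_inner) manifold \<Rightarrow> ('a \<Rightarrow> ('a, 'e) tangent) \<Rightarrow>
      real set \<Rightarrow> (real \<Rightarrow> 'a) \<Rightarrow> bool" where
  "integral_curve P Z I \<zeta> \<longleftrightarrow> open I \<and> is_interval I \<and> smooth_map (interval_manifold I) P \<zeta> \<and>
    (\<forall>t\<in>I. tangent_map (interval_manifold I) P \<zeta> (unit_field I t) = Z (\<zeta> t))"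

definition constant_of_motion ::
    "('a, 'e::finite_dim_inner) manifold \<Rightarrow> ('a \<Rightarrow> ('a, 'e) tangent) \<Rightarrow>
      ('b, 'f::finite_dim_inner) manifold \<Rightarrow> ('a \<Rightarrow> 'b) \<Rightarrow> bool" where
  "constant_of_motion P Z N F \<longleftrightarrow> smooth_map P N F \<and>
    (\<forall>I \<zeta>. integral_curve P Z I \<zeta> \<longrightarrow> (F \<circ> \<zeta>) constant_on I)"

section \<open>Slicings\<close>

definition slicing ::
    "('p, 'e::finite_dim_inner) manifold \<Rightarrow> ('p \<Rightarrow> ('p, 'e) tangent) \<Rightarrow>
      ('m, 'f::finite_dim_inner) manifold \<Rightarrow> ('m \<Rightarrow> 'p) \<Rightarrow> ('m \<Rightarrow> ('m, 'f) tangent) \<Rightarrow> bool" where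
  "slicing P Z M \<alpha> X \<longleftrightarrow> smooth_map M P \<alpha> \<and> vector_field M X \<and>
    (\<forall>x\<in>points M. tangent_map M P \<alpha> (X x) = Z (\<alpha> x))"

definition complete_slicing ::
    "('p, 'e::finite_dim_inner) manifold \<Rightarrow> ('p \<Rightarrow> ('p, 'e) tangent) \<Rightarrow>
      ('m, 'f::finite_dim_inner) manifold \<Rightarrow> ('n, 'g::finite_dim_inner) manifold \<Rightarrow>
      ('m \<times> 'n \<Rightarrow> 'p) \<Rightarrow> ('m \<times> 'n \<Rightarrow> ('m, 'f) tangent) \<Rightarrow> bool" where
  "complete_slicing P Z M N \<alpha> X \<longleftrightarrow>
    smooth_map (prod_manifold M N) P \<alpha> \<and>
    smooth_map (prod_manifold M N) (tangent_bundle M) X \<and>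
    (\<forall>(x, c)\<in>points (prod_manifold M N). fst (X (x, c)) = x) \<and>
    (\<alpha> ` points (prod_manifold M N) = points P \<or>
      openin (mtop P) (\<alpha> ` points (prod_manifold M N)) \<and>
      mtop P closure_of (\<alpha> ` points (prod_manifold M N)) = points P) \<and>
    (\<forall>c\<in>points N. slicing P Z M (\<lambda>x. \<alpha> (x, c)) (\<lambda>x. X (x, c)))"

definition is_complete_slicing ::
    "('p, 'e::finite_dim_inner) manifold \<Rightarrow> ('p \<Rightarrow> ('p, 'e) tangent) \<Rightarrow>
      ('m, 'f::finite_dim_inner) manifold \<Rightarrow> ('n, 'g::finite_dim_inner) manifold \<Rightarrow>
      ('m \<times> 'n \<Rightarrow> 'p) \<Rightarrow> bool" where
  "is_complete_slicing P Z M N \<alpha> \<longleftrightarrow> (\<exists>X. complete_slicing P Z M N \<alpha> X)"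

end

theory Submission
  imports Defs
begin

text \<open>Both sides are equivalent to \<open>TF \<circ> Z = 0\<close>. Along an integral curve \<open>\<zeta>\<close> the derivative of \<open>F \<circ> \<zeta>\<close> is
  \<open>TF (Z \<circ> \<zeta>)\<close>, and by the Picard--Lindeloef theorem there is an integral curve through every
  point; hence \<open>F\<close> is a constant of the motion iff \<open>TF \<circ> Z = 0\<close>. For a complete slicing,
  \<open>TF (Z \<circ> \<alpha>\<^sub>q) = TF (T\<alpha>\<^sub>q X\<^sub>q) = 0\<close>, as \<open>F \<circ> \<alpha>\<^sub>q\<close> is constant. Conversely, if \<open>TF \<circ> Z = 0\<close>, put
  \<open>X = TG \<circ> Z \<circ> \<alpha>\<close> with \<open>G = pr\<^sub>1 \<circ> \<alpha>\<^sup>-\<^sup>1\<close>; the slicing equation is the derivative of \<open>\<alpha> \<circ> (G, F) = id\<close>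
  in the direction of \<open>Z\<close>.\<close>

section \<open>Finite-dimensional model spaces\<close>

text \<open>The condition TF o Z = 0 is pointwise and is stated in charts
  (\<open>annihilates\<close>), so both implications become computations with derivatives of local
  representatives. In a product chart, D alpha (DG v, DF v) = v; once DF v = 0, the vector DG v
  solves the slicing equation, because D alpha (w, 0) is the derivative of alpha_q in direction w.
  The passage from TF o Z = 0 to constancy is only local, since a chart of N need not contain the
  image of a whole integral curve; connectedness of the interval globalises it. X must be smooth on
  M x N and also on M for each fixed q, which is why \<open>smooth_map_tangent_map_field\<close>
  treats Z along an arbitrary smooth map. A model space is only known to have a finite spanning set.
  Orthonormal coordinates supply the analytic facts that depend on dimension: completeness, for the
  fixed point argument, and control of a derivative by its values in finitely many directions, for
  the chain rule and the local Lipschitz bound.\<close>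

lemma orthonormal_basis:
  "\<exists>B :: 'a::finite_dim_inner set. finite B \<and> (\<forall>x. x = (\<Sum>b\<in>B. (x \<bullet> b) *\<^sub>R b))"
proof -
  \<comment> \<open>Gram-Schmidt by induction: \<open>x\<close> minus its projection
    \<open>s\<close> onto the span of \<open>C\<close> is normalised and adjoined, unless it
    vanishes.\<close>
  have *: "\<exists>C. finite C \<and> S \<subseteq> span C \<and> (\<forall>b\<in>C. \<forall>c\<in>C. b \<bullet> c = (if b = c then 1 else 0))"
    if "finite S" for S :: "'a set"
    using that
  proof induction
    case empty
    then show ?case by (intro exI[of _ "{}"]) auto
  next
    case (insert x S)
    then obtain C where C: "finite C" "S \<subseteq> span C"
      and on: "\<And>b c. b \<in> C \<Longrightarrow> c \<in> C \<Longrightarrow> b \<bullet> c = (if b = c then 1 else 0)"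
      by auto
    define s where "s = (\<Sum>c\<in>C. (x \<bullet> c) *\<^sub>R c)"
    have s: "s \<in> span C" unfolding s_def by (intro span_sum span_scale span_base)
    have orth: "(x - s) \<bullet> b = 0" if "b \<in> C" for b
    proof -
      have "s \<bullet> b = (\<Sum>c\<in>C. if c = b then x \<bullet> b else 0)"
        unfolding s_def inner_sum_left by (rule sum.cong) (auto simp: on that)
      then show ?thesis using C that by (simp add: inner_diff_left)
    qed
    show ?case
    proof (cases "x = s")
      case True
      then show ?thesis using C on s by auto
    next
      case False
      define y where "y = (x - s) /\<^sub>R norm (x - s)"
      have y: "y \<bullet> y = 1" using False by (simp add: y_def dot_square_norm power2_eq_square)
      have yb: "y \<bullet> b = 0" "b \<bullet> y = 0" if "b \<in> C" for b
        using orth[OF that] by (simp_all add: y_def inner_commute)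
      have "x = s + norm (x - s) *\<^sub>R y" using False by (simp add: y_def)
      also have "\<dots> \<in> span (insert y C)"
        using s span_mono[of C "insert y C"]
        by (intro span_add) (auto intro: span_scale span_base)
      finally have "insert x S \<subseteq> span (insert y C)"
        using C span_mono[of C "insert y C"] by auto
      moreover have "\<forall>b\<in>insert y C. \<forall>c\<in>insert y C. b \<bullet> c = (if b = c then 1 else 0)"
        using y yb on by fastforce
      ultimately show ?thesis using C by (intro exI[of _ "insert y C"]) simp
    qed
  qed
  obtain S :: "'a set" where S: "finite S" "span S = UNIV" using finite_dim by blast
  obtain C :: "'a set" where C: "finite C" "S \<subseteq> span C"
    and on: "\<And>b c. b \<in> C \<Longrightarrow> c \<in> C \<Longrightarrow> b \<bullet> c = (if b = c then 1 else 0)"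
    using *[OF S(1)] by blast
  have "x = (\<Sum>b\<in>C. (x \<bullet> b) *\<^sub>R b)" for x
  proof -
    have "x \<in> span C" using S C span_minimal[OF C(2) subspace_span] by auto
    then obtain u where u: "x = (\<Sum>b\<in>C. u b *\<^sub>R b)" using C by (auto simp: span_finite)
    have "x \<bullet> b = u b" if "b \<in> C" for b
    proof -
      have "x \<bullet> b = (\<Sum>c\<in>C. if c = b then u b else 0)"
        unfolding u inner_sum_left by (rule sum.cong) (auto simp: on that)
      then show ?thesis using C that by simp
    qed
    then show ?thesis using u by simp
  qed
  then show ?thesis using C by blast
qed

text \<open>A Cauchy sequence converges in each of its finitely many coordinates. Completeness is
  what the contraction argument in \<open>picard_lindeloef\<close> rests on.\<close>

instance finite_dim_inner \<subseteq> banach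
proof
  fix X :: "nat \<Rightarrow> 'a::finite_dim_inner"
  assume X: "Cauchy X"
  obtain B :: "'a set" where B: "\<And>x. x = (\<Sum>b\<in>B. (x \<bullet> b) *\<^sub>R b)"
    using orthonormal_basis by blast
  have "convergent (\<lambda>n. X n \<bullet> b)" for b
    by (intro Cauchy_convergent bounded_linear.Cauchy[OF bounded_linear_inner_left] X)
  then obtain l where l: "\<And>b. (\<lambda>n. X n \<bullet> b) \<longlonglongrightarrow> l b" unfolding convergent_def by metis
  have "(\<lambda>n. \<Sum>b\<in>B. (X n \<bullet> b) *\<^sub>R b) \<longlonglongrightarrow> (\<Sum>b\<in>B. l b *\<^sub>R b)"
    by (intro tendsto_intros l)
  then show "convergent X" unfolding B[symmetric] convergent_def by blast
qed

section \<open>Calculus of \<open>C\<^sup>k\<close> maps\<close>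

lemma Ck_on_Suc_D: "Ck_on (Suc k) S f \<Longrightarrow> Ck_on k S f"
proof (induction k arbitrary: f)
  case 0
  then show ?case
    by (auto intro!: differentiable_imp_continuous_on
        simp: differentiable_on_def differentiable_at_withinI)
next
  case (Suc k)
  then show ?case by (metis Ck_on.simps(2))
qed

lemma Ck_on_subset: "Ck_on k S f \<Longrightarrow> T \<subseteq> S \<Longrightarrow> Ck_on k T f"
  by (induction k arbitrary: f) (auto intro: continuous_on_subset)

lemma Ck_on_local:
  assumes "\<And>x. x \<in> S \<Longrightarrow> \<exists>T. open T \<and> x \<in> T \<and> Ck_on k T f"
  shows "Ck_on k S f"
  using assms
proof (induction k arbitrary: f)
  case 0
  then show ?case
    by (metis Ck_on.simps(1) continuous_at_imp_continuous_on continuous_on_eq_continuous_at)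
next
  case (Suc k)
  then show ?case by simp metis
qed

text \<open>The derivatives in \<open>Ck_on\<close> are taken \<open>at x\<close>, not within
  \<open>S\<close>, so they also see values off \<open>S\<close>; openness of \<open>S\<close> is
  what makes agreement on \<open>S\<close> sufficient.\<close>

lemma Ck_on_cong:
  assumes "open S" "\<And>x. x \<in> S \<Longrightarrow> f x = g x" "Ck_on k S f"
  shows "Ck_on k S g"
  using assms(2,3)
proof (induction k arbitrary: f g)
  case 0
  then show ?case by (metis Ck_on.simps(1) continuous_on_cong)
next
  case (Suc k)
  have d: "f differentiable (at x)" if "x \<in> S" for x using Suc.prems that by simp
  have d': "g differentiable (at x)" if "x \<in> S" for x
    using d[OF that] has_derivative_transform_within_open[OF _ assms(1) that, of f _ UNIV g] Suc.prems(1)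
    unfolding differentiable_def by blast
  have "Ck_on k S (\<lambda>x. frechet_derivative g (at x) v)" for v
  proof (rule Suc.IH)
    show "Ck_on k S (\<lambda>x. frechet_derivative f (at x) v)" using Suc.prems by simp
    show "frechet_derivative f (at x) v = frechet_derivative g (at x) v" if "x \<in> S" for x
      using frechet_derivative_transform_within_open[OF d[OF that] assms(1) that Suc.prems(1)]
      by simp
  qed
  then show ?case using d' by simp
qed

text \<open>Permits the use of any explicit derivative in place of the chosen
  \<open>frechet_derivative\<close>; the closure properties below are inductions with this
  rule.\<close>

lemma Ck_on_SucI:
  assumes "open S" "\<And>x. x \<in> S \<Longrightarrow> (f has_derivative f' x) (at x)"
    and "\<And>v. Ck_on k S (\<lambda>x. f' x v)"
  shows "Ck_on (Suc k) S f"
proof -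
  have "Ck_on k S (\<lambda>x. frechet_derivative f (at x) v)" for v
    by (rule Ck_on_cong[OF assms(1) _ assms(3)[of v]])
      (simp add: frechet_derivative_at[OF assms(2), symmetric])
  then show ?thesis using assms(2) by (auto simp: differentiable_def)
qed

lemma Ck_on_SucE:
  assumes "Ck_on (Suc k) S f"
  shows "x \<in> S \<Longrightarrow> (f has_derivative frechet_derivative f (at x)) (at x)"
    and "Ck_on k S (\<lambda>x. frechet_derivative f (at x) v)"
  using assms by (simp_all add: frechet_derivative_works)

lemma Ck_on_const: "open S \<Longrightarrow> Ck_on k S (\<lambda>x. c)"
  by (induction k arbitrary: c) (auto intro!: Ck_on_SucI derivative_eq_intros)

lemma Ck_on_bounded_linear:
  assumes "bounded_linear L" "open S" "Ck_on k S f"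
  shows "Ck_on k S (\<lambda>x. L (f x))"
  using assms(3)
proof (induction k arbitrary: f)
  case 0
  then show ?case using assms(1) by (simp add: bounded_linear.continuous_on)
next
  case (Suc k)
  show ?case
    by (rule Ck_on_SucI[OF assms(2)])
      (auto intro!: bounded_linear.has_derivative[OF assms(1)] Suc.IH Ck_on_SucE[OF Suc.prems])
qed

lemma Ck_on_id: "open S \<Longrightarrow> Ck_on k S (\<lambda>x. x)"
  by (cases k) (auto intro!: Ck_on_SucI derivative_intros Ck_on_const continuous_on_id)

lemma Ck_on_add:
  assumes "open S" "Ck_on k S f" "Ck_on k S g"
  shows "Ck_on k S (\<lambda>x. f x + g x)"
  using assms(2,3)
proof (induction k arbitrary: f g)
  case 0
  then show ?case by (simp add: continuous_on_add)
next
  case (Suc k)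
  show ?case
    by (rule Ck_on_SucI[OF assms(1)])
      (auto intro!: has_derivative_add Suc.IH Ck_on_SucE[OF Suc.prems(1)] Ck_on_SucE[OF Suc.prems(2)])
qed

lemma Ck_on_sum:
  assumes "open S" "\<And>i. i \<in> I \<Longrightarrow> Ck_on k S (f i)"
  shows "Ck_on k S (\<lambda>x. \<Sum>i\<in>I. f i x)"
  using assms(2)
  by (induction I rule: infinite_finite_induct)
    (simp_all add: Ck_on_const[OF assms(1)] Ck_on_add[OF assms(1)])

lemma Ck_on_scaleR:
  assumes "open S" "Ck_on k S f" "Ck_on k S g"
  shows "Ck_on k S (\<lambda>x. f x *\<^sub>R g x)"
  using assms(2,3)
proof (induction k arbitrary: f g)
  case 0
  then show ?case by (simp add: continuous_on_scaleR)
next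
  case (Suc k)
  note f = Ck_on_SucE[OF Suc.prems(1)] and g = Ck_on_SucE[OF Suc.prems(2)]
  show ?case
    \<comment> \<open>The product rule keeps one factor undifferentiated, so its lower regularity
      has to be extracted with \<open>Ck_on_Suc_D\<close>.\<close>
    by (rule Ck_on_SucI[OF assms(1) has_derivative_scaleR[OF f(1) g(1)]])
      (auto intro!: Ck_on_add Suc.IH assms(1) f g Ck_on_Suc_D[OF Suc.prems(1)]
        Ck_on_Suc_D[OF Suc.prems(2)])
qed

lemma Ck_on_Pair:
  assumes "open S" "Ck_on k S f" "Ck_on k S g"
  shows "Ck_on k S (\<lambda>x. (f x, g x))"
  using assms(2,3)
proof (induction k arbitrary: f g)
  case 0
  then show ?case by (simp add: continuous_on_Pair)
next
  case (Suc k)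
  show ?case
    by (rule Ck_on_SucI[OF assms(1)])
      (auto intro!: has_derivative_Pair Suc.IH Ck_on_SucE[OF Suc.prems(1)] Ck_on_SucE[OF Suc.prems(2)])
qed

text \<open>\<open>Ck_on\<close> controls a derivative in fixed directions only, while the chain
  rule applies it in a direction that varies with the point. Expanding \<open>w x\<close> in a
  finite basis reduces the second situation to the first.\<close>

lemma Ck_on_linear_apply:
  fixes w :: "'a::real_normed_vector \<Rightarrow> 'b::finite_dim_inner"
  assumes "open S" "\<And>x. x \<in> S \<Longrightarrow> linear (L x)"
    and "\<And>b. Ck_on k S (\<lambda>x. L x b)" "Ck_on k S w"
  shows "Ck_on k S (\<lambda>x. L x (w x))"
proof -
  obtain B :: "'b set" where B: "\<And>x. x = (\<Sum>b\<in>B. (x \<bullet> b) *\<^sub>R b)"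
    using orthonormal_basis by blast
  show ?thesis
  proof (rule Ck_on_cong[OF assms(1)])
    show "Ck_on k S (\<lambda>x. \<Sum>b\<in>B. (w x \<bullet> b) *\<^sub>R L x b)"
      by (intro Ck_on_sum Ck_on_scaleR assms Ck_on_bounded_linear[OF bounded_linear_inner_left])
    show "(\<Sum>b\<in>B. (w x \<bullet> b) *\<^sub>R L x b) = L x (w x)" if "x \<in> S" for x
    proof -
      interpret linear "L x" using assms(2)[OF that] .
      have "L x (w x) = L x (\<Sum>b\<in>B. (w x \<bullet> b) *\<^sub>R b)" using B[of "w x"] by (rule arg_cong)
      then show ?thesis by (simp add: sum scale)
    qed
  qed
qed

text \<open>The induction generalises over \<open>g\<close> alone: its hypothesis is applied to the
  directional derivatives of \<open>g\<close>, composed with the same \<open>f\<close>.\<close>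

lemma Ck_on_compose:
  fixes f :: "'a::real_normed_vector \<Rightarrow> 'b::finite_dim_inner"
  assumes "open S" "f ` S \<subseteq> T" "Ck_on k S f" "Ck_on k T g"
  shows "Ck_on k S (\<lambda>x. g (f x))"
  using assms(3,4)
proof (induction k arbitrary: g)
  case 0
  then show ?case using assms(2) by (auto intro: continuous_on_compose2)
next
  case (Suc k)
  note f = Ck_on_SucE[OF Suc.prems(1)] and g = Ck_on_SucE[OF Suc.prems(2)]
  have gf: "(g has_derivative frechet_derivative g (at (f x))) (at (f x))" if "x \<in> S" for x
    using g(1) assms(2) that by blast
  show ?case
  proof (rule Ck_on_SucI[OF assms(1)])
    show "((\<lambda>x. g (f x)) has_derivative
        (\<lambda>v. frechet_derivative g (at (f x)) (frechet_derivative f (at x) v))) (at x)"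
      if "x \<in> S" for x
      using has_derivative_compose[OF f(1)[OF that] gf[OF that]] .
    show "Ck_on k S (\<lambda>x. frechet_derivative g (at (f x)) (frechet_derivative f (at x) v))" for v
    proof (rule Ck_on_linear_apply[OF assms(1)])
      show "linear (frechet_derivative g (at (f x)))" if "x \<in> S" for x
        using has_derivative_linear[OF gf[OF that]] .
      show "Ck_on k S (\<lambda>x. frechet_derivative g (at (f x)) b)" for b
        using Suc.IH[OF Ck_on_Suc_D[OF Suc.prems(1)] g(2)] .
    qed (rule f(2))
  qed
qed

section \<open>Maps of class C-infinity\<close>

lemma smooth_on_differentiable: "smooth_on S f \<Longrightarrow> x \<in> S \<Longrightarrow> f differentiable (at x)"
  unfolding smooth_on_def by (metis Ck_on.simps(2))

lemma smooth_on_derivative: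
  "smooth_on S f \<Longrightarrow> x \<in> S \<Longrightarrow> (f has_derivative frechet_derivative f (at x)) (at x)"
  using smooth_on_differentiable frechet_derivative_works by blast

lemma smooth_on_continuous: "smooth_on S f \<Longrightarrow> continuous_on S f"
  unfolding smooth_on_def by (metis Ck_on.simps(1))

lemma smooth_on_subset: "smooth_on S f \<Longrightarrow> T \<subseteq> S \<Longrightarrow> smooth_on T f"
  unfolding smooth_on_def using Ck_on_subset by blast

lemma smooth_on_cong: "open S \<Longrightarrow> smooth_on S f \<Longrightarrow> (\<And>x. x \<in> S \<Longrightarrow> f x = g x) \<Longrightarrow> smooth_on S g"
  unfolding smooth_on_def using Ck_on_cong by metis

lemma smooth_on_local:
  "(\<And>x. x \<in> S \<Longrightarrow> \<exists>T. open T \<and> x \<in> T \<and> smooth_on T f) \<Longrightarrow> smooth_on S f"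
  unfolding smooth_on_def by (intro allI Ck_on_local) blast

lemma smooth_on_const: "open S \<Longrightarrow> smooth_on S (\<lambda>x. c)"
  by (simp add: smooth_on_def Ck_on_const)

lemma smooth_on_id: "open S \<Longrightarrow> smooth_on S (\<lambda>x. x)"
  by (simp add: smooth_on_def Ck_on_id)

lemma smooth_on_Pair:
  "open S \<Longrightarrow> smooth_on S f \<Longrightarrow> smooth_on S g \<Longrightarrow> smooth_on S (\<lambda>x. (f x, g x))"
  by (simp add: smooth_on_def Ck_on_Pair)

lemma smooth_on_bounded_linear:
  "bounded_linear L \<Longrightarrow> open S \<Longrightarrow> smooth_on S f \<Longrightarrow> smooth_on S (\<lambda>x. L (f x))"
  by (simp add: smooth_on_def Ck_on_bounded_linear)

lemma smooth_on_compose: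
  fixes f :: "'a::real_normed_vector \<Rightarrow> 'b::finite_dim_inner"
  shows "open S \<Longrightarrow> f ` S \<subseteq> T \<Longrightarrow> smooth_on S f \<Longrightarrow> smooth_on T g \<Longrightarrow> smooth_on S (\<lambda>x. g (f x))"
  unfolding smooth_on_def by (blast intro: Ck_on_compose)

text \<open>Each order k for the result uses order k + 1 for \<open>g\<close>. This is the analytic
  core of the smoothness of the field X: there \<open>g\<close> represents G, \<open>f\<close>
  represents alpha, and \<open>w\<close> is the principal part of Z along alpha.\<close>

lemma smooth_on_derivative_apply:
  fixes f :: "'a::real_normed_vector \<Rightarrow> 'b::finite_dim_inner"
  assumes "open S" "f ` S \<subseteq> T" "smooth_on S f" "smooth_on T g" "smooth_on S w"
  shows "smooth_on S (\<lambda>x. frechet_derivative g (at (f x)) (w x))"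
  unfolding smooth_on_def
proof
  fix k
  have g: "Ck_on (Suc k) T g" using assms(4) unfolding smooth_on_def by blast
  show "Ck_on k S (\<lambda>x. frechet_derivative g (at (f x)) (w x))"
  proof (rule Ck_on_linear_apply[OF assms(1)])
    show "linear (frechet_derivative g (at (f x)))" if "x \<in> S" for x
      using has_derivative_linear[OF Ck_on_SucE(1)[OF g]] assms(2) that by blast
    show "Ck_on k S (\<lambda>x. frechet_derivative g (at (f x)) b)" for b
      using assms(3) Ck_on_compose[OF assms(1,2) _ Ck_on_SucE(2)[OF g]] by (simp add: smooth_on_def)
    show "Ck_on k S w" using assms(5) by (simp add: smooth_on_def)
  qed
qed

section \<open>Ordinary differential equations\<close>

text \<open>The Picard operator is a contraction on curves that stay in the ball, the only region
  where \<open>f\<close> is controlled. Curves are defined on the whole line, with time clamped to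
  [-e, e], so that they live in the complete space of bounded continuous functions.\<close>

lemma picard_lindeloef:
  fixes f :: "'a::banach \<Rightarrow> 'a"
  assumes r: "0 < r" and lip: "L-lipschitz_on (cball x0 r) f"
  obtains e y where "0 < e" "y 0 = x0" "\<And>t. y t \<in> cball x0 r"
    "\<And>t. t \<in> {-e<..<e} \<Longrightarrow> (y has_vector_derivative f (y t)) (at t)"
proof -
  have L: "0 \<le> L" using lip by (rule lipschitz_on_nonneg)
  define K where "K = norm (f x0) + L * r"
  have K: "0 \<le> K" using L r by (simp add: K_def)
  have fK: "norm (f z) \<le> K" if "z \<in> cball x0 r" for z
  proof -
    have "dist (f z) (f x0) \<le> L * dist z x0" using lipschitz_onD[OF lip that] r by simp
    also have "\<dots> \<le> L * r" using that L by (intro mult_left_mono) (auto simp: dist_commute)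
    finally show ?thesis using norm_triangle_sub[of "f z" "f x0"] by (simp add: K_def dist_norm)
  qed
  \<comment> \<open>\<open>J\<close> below combines two integrals over intervals of length at most
    2e and e, whence the factor 3. The first bound gives 3Ke <= r, so that iterates stay in the
    ball; the second gives 3Le <= 1/2, the contraction factor. The summands 1 keep the denominators
    positive.\<close>
  define e where "e = min (r / (3 * K + 1)) (1 / (6 * L + 1))"
  have e: "0 < e" using r K L by (simp add: e_def)
  have "e * (3 * K + 1) \<le> r" "e * (6 * L + 1) \<le> 1"
    using K L by (simp_all add: e_def min_mult_distrib_right min.coboundedI1 min.coboundedI2)
  then have Ke: "3 * (K * e) \<le> r" and Le: "3 * (L * e) \<le> 1 / 2"
    using e by (simp_all add: algebra_simps)
  define cl where "cl t = max (-e) (min e t)" for t :: real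
  have cl: "-e \<le> cl t" "cl t \<le> e" for t using e by (auto simp: cl_def)
  \<comment> \<open>This is the oriented integral from 0 to \<open>cl t\<close>; basing both terms
    at -e avoids a case distinction on the sign of \<open>t\<close>.\<close>
  define J where "J h t = integral {-e..cl t} h - integral {-e..0} h" for h :: "real \<Rightarrow> 'a" and t
  have J_bound: "norm (J h t) \<le> 3 * (C * e)"
    if h: "continuous_on {-e..e} h" and C: "\<And>s. s \<in> {-e..e} \<Longrightarrow> norm (h s) \<le> C" for h C t
  proof -
    have "0 \<le> C" using C[of 0] e norm_ge_zero[of "h 0"] by (auto simp del: norm_ge_zero)
    have "norm (integral {-e..cl t} h) \<le> C * (cl t - (-e))"
      using cl[of t] by (intro integral_bound continuous_on_subset[OF h] C) auto
    also have "\<dots> \<le> C * (2 * e)" using \<open>0 \<le> C\<close> cl[of t] by (intro mult_left_mono) auto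
    finally have 1: "norm (integral {-e..cl t} h) \<le> C * (2 * e)" .
    have "norm (integral {-e..0} h) \<le> C * (0 - (-e))"
      using e by (intro integral_bound continuous_on_subset[OF h] C) auto
    then show ?thesis
      using 1 norm_triangle_ineq4[of "integral {-e..cl t} h" "integral {-e..0} h"]
      by (simp add: J_def)
  qed
  have J_cont: "continuous_on UNIV (J h)" if h: "continuous_on {-e..e} h" for h
  proof -
    have "continuous_on UNIV (\<lambda>t. integral {-e..cl t} h)"
      by (rule continuous_on_compose2[OF indefinite_integral_continuous_1
            [OF integrable_continuous_real[OF h]]])
        (auto simp: cl_def[abs_def] e less_imp_le intro!: continuous_intros)
    then show ?thesis unfolding J_def[abs_def] by (intro continuous_intros)
  qed
  define S :: "(real \<Rightarrow>\<^sub>C 'a) set" where "S = PiC UNIV (\<lambda>_. cball x0 r)"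
  have S: "y \<in> S \<longleftrightarrow> (\<forall>t. y t \<in> cball x0 r)" for y by (auto simp: S_def mem_PiC_iff)
  have fy_cont: "continuous_on T (\<lambda>t. f (y t))" if "y \<in> S" for y :: "real \<Rightarrow>\<^sub>C 'a" and T
    by (rule continuous_on_compose2[OF lipschitz_on_continuous_on[OF lip]])
      (use that in \<open>auto simp: S\<close>)
  \<comment> \<open>\<open>Bcontfun\<close> is meaningful only for bounded continuous functions; on
    \<open>S\<close> both properties follow from \<open>J_fy\<close> and
    \<open>J_cont\<close>.\<close>
  define \<Phi> where "\<Phi> y = Bcontfun (\<lambda>t. x0 + J (\<lambda>s. f (apply_bcontfun y s)) t)" for y
  have J_fy: "norm (J (\<lambda>s. f (y s)) t) \<le> r" if "y \<in> S" for y :: "real \<Rightarrow>\<^sub>C 'a" and t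
    using J_bound[OF fy_cont[OF that], of K t] Ke fK that by (force simp: S)
  have \<Phi>: "\<Phi> y t = x0 + J (\<lambda>s. f (y s)) t" if "y \<in> S" for y :: "real \<Rightarrow>\<^sub>C 'a" and t
  proof -
    have "(\<lambda>t. x0 + J (\<lambda>s. f (y s)) t) \<in> bcontfun"
    proof (rule bcontfun_normI)
      show "norm (x0 + J (\<lambda>s. f (y s)) t) \<le> norm x0 + r" for t
        using J_fy[OF that, of t] norm_triangle_ineq[of x0 "J (\<lambda>s. f (y s)) t"] by simp
    qed (intro continuous_intros J_cont fy_cont that)
    then show ?thesis by (simp add: \<Phi>_def Bcontfun_inverse)
  qed
  have "\<exists>!y\<in>S. \<Phi> y = y"
  proof (rule Banach_fix)
    show "complete S" unfolding S_def complete_eq_closed by (rule closed_PiC) simp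
    have "const_bcontfun x0 \<in> S" using r by (simp add: S const_bcontfun.rep_eq)
    then show "S \<noteq> {}" by blast
    show "\<Phi> ` S \<subseteq> S" using J_fy by (auto simp: \<Phi> S dist_norm)
    show "dist (\<Phi> y) (\<Phi> z) \<le> 1 / 2 * dist y z" if yz: "y \<in> S" "z \<in> S" for y z
    proof (rule dist_bound)
      fix t
      let ?h = "\<lambda>s. f (y s) - f (z s)"
      have "norm (?h s) \<le> L * dist y z" for s
      proof -
        have "norm (?h s) \<le> L * dist (y s) (z s)"
          using lipschitz_onD[OF lip, of "y s" "z s"] yz by (auto simp: S dist_norm)
        also have "\<dots> \<le> L * dist y z" by (intro mult_left_mono dist_bounded L)
        finally show ?thesis .
      qed
      then have "norm (J ?h t) \<le> 3 * (L * dist y z * e)"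
        by (intro J_bound continuous_intros fy_cont yz)
      also have "\<dots> = 3 * (L * e) * dist y z" by simp
      also have "\<dots> \<le> 1 / 2 * dist y z" using Le by (intro mult_right_mono) auto
      also have "J ?h t = J (\<lambda>s. f (y s)) t - J (\<lambda>s. f (z s)) t"
        by (simp add: J_def integral_diff integrable_continuous_real fy_cont yz)
      finally show "dist (\<Phi> y t) (\<Phi> z t) \<le> 1 / 2 * dist y z"
        using yz by (simp add: \<Phi> dist_norm)
    qed
  qed auto
  then obtain y where y: "y \<in> S" "\<Phi> y = y" by blast
  have y_eq: "y t = x0 + J (\<lambda>s. f (y s)) t" for t using \<Phi>[OF y(1), of t] y(2) by simp
  show ?thesis
  proof
    show "0 < e" by (rule e)
    show "y 0 = x0" using y_eq[of 0] e by (simp add: J_def cl_def)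
    show "y t \<in> cball x0 r" for t using y(1) S by blast
    fix t assume t: "t \<in> {-e<..<e}"
    \<comment> \<open>The fundamental theorem gives a derivative within [-e, e]. At an interior time
      this is a full derivative, and the clamp is the identity nearby.\<close>
    have "((\<lambda>u. integral {-e..u} (\<lambda>s. f (y s))) has_vector_derivative f (y t)) (at t within {-e..e})"
      using t by (intro integral_has_vector_derivative fy_cont y(1)) auto
    moreover have "at t within {-e..e} = at t" using t by (intro at_within_interior) simp
    ultimately have "((\<lambda>u. x0 + (integral {-e..u} (\<lambda>s. f (y s)) - integral {-e..0} (\<lambda>s. f (y s))))
        has_vector_derivative f (y t)) (at t)"
      by (auto intro!: derivative_eq_intros)
    then show "(y has_vector_derivative f (y t)) (at t)"
      by (rule has_vector_derivative_transform_within_open[OF _ open_greaterThanLessThan t])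
        (auto simp: y_eq[symmetric] intro!: trans[OF _ y_eq[symmetric]] simp: J_def cl_def)
  qed
qed

text \<open>Continuity of the derivative is known for each direction separately. Over a finite basis
  the bounds \<open>K b\<close> hold simultaneously near \<open>x0\<close>, and they bound the
  operator norm by the constant \<open>C\<close>; the ball is convex, so the mean value inequality
  applies.\<close>

lemma Ck_on_locally_lipschitz:
  fixes f :: "'a::finite_dim_inner \<Rightarrow> 'b::real_normed_vector"
  assumes "open U" "x0 \<in> U" "Ck_on (Suc 0) U f"
  obtains r L where "0 < r" "cball x0 r \<subseteq> U" "L-lipschitz_on (cball x0 r) f"
proof -
  obtain B :: "'a set" where B: "finite B" "\<And>x. x = (\<Sum>b\<in>B. (x \<bullet> b) *\<^sub>R b)"
    using orthonormal_basis by blast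
  define D where "D x = frechet_derivative f (at x)" for x
  define K where "K b = norm (D x0 b) + 1" for b
  note f = Ck_on_SucE[OF assms(3), folded D_def]
  have "\<forall>\<^sub>F x in nhds x0. norm (D x b) < K b" for b
  proof -
    have "continuous_on U (\<lambda>x. norm (D x b))"
      using f(2)[of b] by (auto intro: continuous_on_norm)
    then have "(\<lambda>x. norm (D x b)) \<midarrow>x0\<rightarrow> norm (D x0 b)"
      using assms(1,2) by (simp add: continuous_on_eq_continuous_at continuous_at)
    then have "\<forall>\<^sub>F x in at x0. norm (D x b) < K b"
      by (rule order_tendstoD) (simp add: K_def)
    then show ?thesis by (simp add: eventually_nhds_conv_at K_def)
  qed
  then have "\<forall>\<^sub>F x in nhds x0. x \<in> U \<and> (\<forall>b\<in>B. norm (D x b) < K b)"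
    using B(1) assms(1,2) by (simp add: eventually_conj_iff eventually_ball_finite eventually_nhds_in_open)
  then obtain d where d: "0 < d" "\<And>x. dist x x0 < d \<Longrightarrow> x \<in> U \<and> (\<forall>b\<in>B. norm (D x b) < K b)"
    unfolding eventually_nhds_metric by blast
  define C where "C = (\<Sum>b\<in>B. norm b * K b)"
  have C: "0 \<le> C" by (auto simp: C_def K_def intro!: sum_nonneg)
  have sub: "x \<in> U \<and> (\<forall>b\<in>B. norm (D x b) < K b)" if "x \<in> cball x0 (d / 2)" for x
    using d(2)[of x] d(1) that by (simp add: dist_commute)
  have "C-lipschitz_on (cball x0 (d / 2)) f"
  proof (rule bounded_derivative_imp_lipschitz)
    fix x assume x: "x \<in> cball x0 (d / 2)"
    have D: "(f has_derivative D x) (at x)" using f(1) sub[OF x] by blast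
    then show "(f has_derivative D x) (at x within cball x0 (d / 2))"
      by (rule has_derivative_at_withinI)
    interpret linear "D x" using has_derivative_linear[OF D] .
    show "onorm (D x) \<le> C"
    proof (rule onorm_bound[OF C])
      fix v
      have "D x v = D x (\<Sum>b\<in>B. (v \<bullet> b) *\<^sub>R b)" using B(2)[of v] by (rule arg_cong)
      also have "norm \<dots> \<le> (\<Sum>b\<in>B. norm ((v \<bullet> b) *\<^sub>R D x b))"
        unfolding sum scale by (rule norm_sum)
      also have "\<dots> \<le> (\<Sum>b\<in>B. norm v * norm b * K b)"
        unfolding norm_scaleR
        by (intro sum_mono mult_mono) (use Cauchy_Schwarz_ineq2[of v] sub[OF x] in \<open>auto intro: less_imp_le\<close>)
      also have "\<dots> = C * norm v" by (simp add: C_def sum_distrib_left mult_ac)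
      finally show "norm (D x v) \<le> C * norm v" .
    qed
  qed (auto intro: C)
  moreover have "cball x0 (d / 2) \<subseteq> U" using sub by blast
  ultimately show ?thesis using that[of "d / 2" C] d(1) by simp
qed

text \<open>Bootstrapping: if the solution \<open>y\<close> is of class C^k, so is its derivative
  \<open>f (y t)\<close>, hence \<open>y\<close> is of class C^(k+1).\<close>

lemma smooth_ode_solution:
  fixes f :: "'a::finite_dim_inner \<Rightarrow> 'a"
  assumes "open U" "x0 \<in> U" "smooth_on U f"
  obtains e y where "0 < e" "y 0 = x0" "y ` {-e<..<e} \<subseteq> U" "smooth_on {-e<..<e} y"
    "\<And>t. t \<in> {-e<..<e} \<Longrightarrow> (y has_vector_derivative f (y t)) (at t)"
proof -
  obtain r L where rL: "0 < r" "cball x0 r \<subseteq> U" "L-lipschitz_on (cball x0 r) f"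
    using Ck_on_locally_lipschitz[OF assms(1,2)] assms(3) unfolding smooth_on_def by blast
  obtain e y where y: "0 < e" "y 0 = x0" "\<And>t. y t \<in> cball x0 r"
    "\<And>t. t \<in> {-e<..<e} \<Longrightarrow> (y has_vector_derivative f (y t)) (at t)"
    using picard_lindeloef[OF rL(1,3)] by blast
  have U: "y ` {-e<..<e} \<subseteq> U" using y(3) rL(2) by blast
  have "Ck_on k {-e<..<e} y" for k
  proof (induction k)
    case 0
    then show ?case
      by (auto intro!: continuous_at_imp_continuous_on has_vector_derivative_continuous[OF y(4)])
  next
    case (Suc k)
    have "Ck_on k {-e<..<e} (\<lambda>t. f (y t))"
      by (rule Ck_on_compose[OF _ U Suc]) (use assms(3) in \<open>simp_all add: smooth_on_def\<close>)
    then show ?case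
      using y(4) by (intro Ck_on_SucI[where f' = "\<lambda>t v. v *\<^sub>R f (y t)"] Ck_on_scaleR Ck_on_const)
        (auto simp: has_vector_derivative_def)
  qed
  then show ?thesis using that[OF y(1,2) U _ y(4)] by (simp add: smooth_on_def)
qed

section \<open>Charts and smooth maps\<close>

text \<open>The topological half of the manifold axioms that concerns charts. Products and intervals
  enter the proof through this property; the full \<open>smooth_manifold\<close> is assumed where
  chart changes are differentiated.\<close>

definition charted :: "('a, 'e::finite_dim_inner) manifold \<Rightarrow> bool" where
  "charted M \<longleftrightarrow> (\<Union>c\<in>atlas M. fst c) = points M \<and>
    (\<forall>c\<in>atlas M. openin (mtop M) (fst c) \<and> open (snd c ` fst c) \<and>
      homeomorphic_map (subtopology (mtop M) (fst c)) (top_of_set (snd c ` fst c)) (snd c))"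

text \<open>The set on which \<open>local_rep c d f\<close> really is the coordinate expression of
  \<open>f\<close>; elsewhere its values are artefacts of \<open>inv_into\<close> or of a chart
  outside its domain.\<close>

definition rep_domain :: "('a, 'e) chart \<Rightarrow> ('b, 'f) chart \<Rightarrow> ('a \<Rightarrow> 'b) \<Rightarrow> 'e set" where
  "rep_domain c d f = snd c ` {x \<in> fst c. f x \<in> fst d}"

abbreviation rep_deriv ::
    "('a, 'e::real_normed_vector) chart \<Rightarrow> ('b, 'f::real_normed_vector) chart \<Rightarrow> ('a \<Rightarrow> 'b) \<Rightarrow> 'a \<Rightarrow> 'e \<Rightarrow> 'f"
  where "rep_deriv c d f p \<equiv> frechet_derivative (local_rep c d f) (at (snd c p))"

lemma smooth_manifold_charted: "smooth_manifold M \<Longrightarrow> charted M"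
  unfolding smooth_manifold_def charted_def by (auto simp: split_beta)

lemma charts_atD: "c \<in> charts_at M p \<Longrightarrow> c \<in> atlas M \<and> p \<in> fst c"
  by (simp add: charts_at_def)

lemma charts_atI: "c \<in> atlas M \<Longrightarrow> p \<in> fst c \<Longrightarrow> c \<in> charts_at M p"
  by (simp add: charts_at_def)

context
  fixes M :: "('a, 'e::finite_dim_inner) manifold"
  assumes M: "charted M"
begin

lemma chart_exists: "p \<in> points M \<Longrightarrow> \<exists>c. c \<in> charts_at M p"
  using M unfolding charted_def charts_at_def by blast

lemma chart_domain_openin: "c \<in> atlas M \<Longrightarrow> openin (mtop M) (fst c)"
  and chart_range_open: "c \<in> atlas M \<Longrightarrow> open (snd c ` fst c)"
  and chart_homeomorphic_map: "c \<in> atlas M \<Longrightarrow>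
    homeomorphic_map (subtopology (mtop M) (fst c)) (top_of_set (snd c ` fst c)) (snd c)"
  using M by (simp_all add: charted_def)

lemma chart_domain_subset: "c \<in> atlas M \<Longrightarrow> fst c \<subseteq> points M"
  using chart_domain_openin openin_subset by blast

lemma charts_at_points: "c \<in> charts_at M p \<Longrightarrow> p \<in> points M"
  using chart_domain_subset[of c] charts_atD[of c M p] by blast

lemma chart_inj: "c \<in> atlas M \<Longrightarrow> inj_on (snd c) (fst c)"
  using homeomorphic_imp_injective_map[OF chart_homeomorphic_map, of c] chart_domain_subset[of c]
  by (simp add: Int_absorb1)

lemma chart_open_image:
  assumes "c \<in> atlas M" "openin (mtop M) V" "V \<subseteq> fst c"
  shows "open (snd c ` V)"
proof -
  have "openin (subtopology (mtop M) (fst c)) V"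
    using assms by (simp add: openin_open_subtopology chart_domain_openin)
  then have "openin (top_of_set (snd c ` fst c)) (snd c ` V)"
    using homeomorphic_imp_open_map[OF chart_homeomorphic_map[OF assms(1)]]
    unfolding open_map_def by blast
  then show ?thesis using openin_open_eq[OF chart_range_open[OF assms(1)]] by simp
qed

lemma chart_open_vimage:
  assumes "c \<in> atlas M" "open W"
  shows "openin (mtop M) {x \<in> fst c. snd c x \<in> W}"
proof -
  have "continuous_map (subtopology (mtop M) (fst c)) (top_of_set (snd c ` fst c)) (snd c)"
    using homeomorphic_imp_continuous_map[OF chart_homeomorphic_map[OF assms(1)]] .
  then have "continuous_map (subtopology (mtop M) (fst c)) euclidean (snd c)"
    by (simp add: continuous_map_in_subtopology)
  then have "openin (subtopology (mtop M) (fst c))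
      {x \<in> topspace (subtopology (mtop M) (fst c)). snd c x \<in> W}"
    using assms(2) by (intro openin_continuous_map_preimage) auto
  then have "openin (subtopology (mtop M) (fst c)) {x \<in> fst c. snd c x \<in> W}"
    using chart_domain_subset[OF assms(1)] by (simp add: Int_absorb1)
  then show ?thesis
    by (simp add: openin_open_subtopology chart_domain_openin[OF assms(1)])
qed

lemma local_rep_chart: "c \<in> atlas M \<Longrightarrow> p \<in> fst c \<Longrightarrow> local_rep c d f (snd c p) = snd d (f p)"
  using chart_inj by (simp add: local_rep_def)

lemma open_chart_preimage:
  assumes "c \<in> atlas M" "continuous_map (mtop M) X f" "openin X V"
  shows "open (snd c ` {x \<in> fst c. f x \<in> V})"
proof (rule chart_open_image[OF assms(1)])
  have "{x \<in> fst c. f x \<in> V} = fst c \<inter> {x \<in> points M. f x \<in> V}"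
    using chart_domain_subset[OF assms(1)] by auto
  then show "openin (mtop M) {x \<in> fst c. f x \<in> V}"
    using openin_continuous_map_preimage[OF assms(2,3)] chart_domain_openin[OF assms(1)] by auto
qed auto

end

section \<open>Smooth maps and derivatives of local representatives\<close>

lemma smooth_map_continuous: "smooth_map M N f \<Longrightarrow> continuous_map (mtop M) (mtop N) f"
  by (simp add: smooth_map_def)

lemma smooth_map_points: "smooth_map M N f \<Longrightarrow> p \<in> points M \<Longrightarrow> f p \<in> points N"
  using continuous_map_image_subset_topspace[OF smooth_map_continuous, of M N f] by blast

lemma smooth_map_local_rep:
  "smooth_map M N f \<Longrightarrow> c \<in> atlas M \<Longrightarrow> d \<in> atlas N \<Longrightarrow> smooth_on (rep_domain c d f) (local_rep c d f)"
  by (simp add: smooth_map_def rep_domain_def)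

lemma open_rep_domain:
  assumes "charted M" "charted N" "smooth_map M N f" "c \<in> atlas M" "d \<in> atlas N"
  shows "open (rep_domain c d f)"
  unfolding rep_domain_def
  using open_chart_preimage[OF assms(1,4) smooth_map_continuous[OF assms(3)]]
    chart_domain_openin[OF assms(2,5)] .

lemma local_rep_has_derivative:
  assumes "smooth_map M N f" "c \<in> charts_at M p" "d \<in> charts_at N (f p)"
  shows "(local_rep c d f has_derivative rep_deriv c d f p) (at (snd c p))"
proof (rule smooth_on_derivative)
  show "smooth_on (rep_domain c d f) (local_rep c d f)"
    using smooth_map_local_rep[OF assms(1)] charts_atD[OF assms(2)] charts_atD[OF assms(3)] by simp
  show "snd c p \<in> rep_domain c d f"
    using assms(2,3) by (auto simp: charts_at_def rep_domain_def)
qed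

text \<open>A coordinate formula \<open>g\<close> for \<open>h\<close> only has to be right near
  \<open>p\<close>. The map \<open>f\<close> and the chart \<open>d\<close> serve to cut out that
  open neighbourhood; with the identity and \<open>d = c\<close> it is the whole chart.\<close>

lemma rep_deriv_eqI:
  assumes "charted M" "charted N" "smooth_map M N f" "c \<in> charts_at M p" "d \<in> charts_at N (f p)"
    and "(g has_derivative g') (at (snd c p))"
    and "\<And>x. x \<in> fst c \<Longrightarrow> f x \<in> fst d \<Longrightarrow> g (snd c x) = snd e (h x)"
  shows "rep_deriv c e h p = g'"
proof -
  have c: "c \<in> atlas M" "p \<in> fst c" and d: "d \<in> atlas N" "f p \<in> fst d"
    using assms(4,5) by (auto simp: charts_at_def)
  have "(local_rep c e h has_derivative g') (at (snd c p))"
  proof (rule has_derivative_transform_within_open[OF assms(6)])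
    show "open (rep_domain c d f)" using open_rep_domain assms(1-3) c d by blast
    show "snd c p \<in> rep_domain c d f" using c d by (auto simp: rep_domain_def)
    show "g y = local_rep c e h y" if "y \<in> rep_domain c d f" for y
      using that by (auto simp: rep_domain_def assms(7) local_rep_chart[OF assms(1) c(1)])
  qed
  then show ?thesis by (rule frechet_derivative_at[symmetric])
qed

text \<open>Besides the chain rule proper, this covers changes of chart in the source or the target,
  by taking \<open>f\<close> or \<open>g\<close> to be the identity.\<close>

lemma rep_deriv_compose:
  assumes "charted M" "charted N" "smooth_map M N f" "smooth_map N Q g"
    and "c \<in> charts_at M p" "d \<in> charts_at N (f p)" "e \<in> charts_at Q (g (f p))"
  shows "rep_deriv c e (\<lambda>x. g (f x)) p v = rep_deriv d e g (f p) (rep_deriv c d f p v)"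
proof -
  have c: "c \<in> atlas M" "p \<in> fst c" and d: "d \<in> atlas N"
    using assms(5,6) by (auto simp: charts_at_def)
  have "local_rep c d f (snd c p) = snd d (f p)" by (rule local_rep_chart[OF assms(1) c])
  then have "((\<lambda>y. local_rep d e g (local_rep c d f y)) has_derivative
      (\<lambda>v. rep_deriv d e g (f p) (rep_deriv c d f p v))) (at (snd c p))"
    using has_derivative_compose[OF local_rep_has_derivative[OF assms(3,5,6)], of "local_rep d e g"]
      local_rep_has_derivative[OF assms(4,6,7)] by simp
  then have "rep_deriv c e (\<lambda>x. g (f x)) p = (\<lambda>v. rep_deriv d e g (f p) (rep_deriv c d f p v))"
    by (rule rep_deriv_eqI[OF assms(1-3,5,6)])
      (simp add: local_rep_chart[OF assms(1) c(1)] local_rep_chart[OF assms(2) d])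
  then show ?thesis by simp
qed

lemma smooth_map_id: "smooth_manifold M \<Longrightarrow> smooth_map M M (\<lambda>x. x)"
  by (auto simp: smooth_manifold_def smooth_map_def Int_def)

text \<open>No single chart of \<open>N\<close> need contain the image under \<open>f\<close> of a
  chart domain of \<open>M\<close>, so smoothness is established near each point, through a chart
  \<open>d\<close> chosen around \<open>f x\<close>.\<close>

lemma smooth_map_compose:
  assumes M: "charted M" and N: "charted N"
    and Q: "\<And>e. e \<in> atlas Q \<Longrightarrow> openin (mtop Q) (fst e)"
    and f: "smooth_map M N f" and g: "smooth_map N Q g"
  shows "smooth_map M Q (\<lambda>x. g (f x))"
  unfolding smooth_map_def
proof (intro conjI ballI)
  have gf: "continuous_map (mtop M) (mtop Q) (\<lambda>x. g (f x))"
    using continuous_map_compose[OF f[THEN smooth_map_continuous] g[THEN smooth_map_continuous]]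
    by (simp add: o_def)
  then show "continuous_map (mtop M) (mtop Q) (\<lambda>x. g (f x))" .
  fix c e assume c: "c \<in> atlas M" and e: "e \<in> atlas Q"
  show "smooth_on (snd c ` {x \<in> fst c. g (f x) \<in> fst e}) (local_rep c e (\<lambda>x. g (f x)))"
  proof (rule smooth_on_local)
    fix y assume "y \<in> snd c ` {x \<in> fst c. g (f x) \<in> fst e}"
    then obtain x where x: "x \<in> fst c" "g (f x) \<in> fst e" "y = snd c x" by blast
    have "f x \<in> points N" using smooth_map_points[OF f] chart_domain_subset[OF M c] x(1) by blast
    then obtain d where d: "d \<in> atlas N" "f x \<in> fst d"
      using chart_exists[OF N, of "f x"] by (auto simp: charts_at_def)
    define T where "T = rep_domain c d f \<inter> snd c ` {x \<in> fst c. g (f x) \<in> fst e}"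
    have T: "open T"
      unfolding T_def using open_rep_domain[OF M N f c d(1)] open_chart_preimage[OF M c gf Q[OF e]]
      by blast
    have T_eq: "T = snd c ` {x \<in> fst c. f x \<in> fst d \<and> g (f x) \<in> fst e}"
      using chart_inj[OF M c] by (auto simp: T_def rep_domain_def inj_on_def)
    have rep: "local_rep c d f (snd c x) = snd d (f x)" if "x \<in> fst c" for x
      using local_rep_chart[OF M c that] .
    have "smooth_on T (\<lambda>y. local_rep d e g (local_rep c d f y))"
    proof (rule smooth_on_compose[OF T, where f = "local_rep c d f"])
      show "local_rep c d f ` T \<subseteq> rep_domain d e g"
        using rep by (auto simp: T_eq rep_domain_def)
      show "smooth_on T (local_rep c d f)"
        using smooth_map_local_rep[OF f c d(1)] by (rule smooth_on_subset) (simp add: T_def)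
      show "smooth_on (rep_domain d e g) (local_rep d e g)"
        using smooth_map_local_rep[OF g d(1) e] .
    qed
    then have "smooth_on T (local_rep c e (\<lambda>x. g (f x)))"
      by (rule smooth_on_cong[OF T])
        (auto simp: T_eq rep local_rep_chart[OF M c] local_rep_chart[OF N d(1)])
    moreover have "y \<in> T" using x d by (auto simp: T_eq)
    ultimately show "\<exists>T. open T \<and> y \<in> T \<and> smooth_on T (local_rep c e (\<lambda>x. g (f x)))"
      using T by blast
  qed
qed

section \<open>Product manifolds\<close>

lemma charted_prod_manifold:
  fixes M :: "('a, 'e::finite_dim_inner) manifold" and N :: "('b, 'f::finite_dim_inner) manifold"
  assumes M: "charted M" and N: "charted N"
  shows "charted (prod_manifold M N)"
  unfolding charted_def
proof (intro conjI ballI)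
  show "(\<Union>c\<in>atlas (prod_manifold M N). fst c) = points (prod_manifold M N)"
  proof -
    have "points (prod_manifold M N) = (\<Union>c\<in>atlas M. fst c) \<times> (\<Union>d\<in>atlas N. fst d)"
      using M N by (simp add: charted_def prod_manifold_def)
    also have "\<dots> = (\<Union>c\<in>atlas M. \<Union>d\<in>atlas N. fst c \<times> fst d)" by blast
    also have "\<dots> = (\<Union>k\<in>atlas (prod_manifold M N). fst k)"
    proof -
      have "atlas (prod_manifold M N) =
          (\<Union>c\<in>atlas M. \<Union>d\<in>atlas N. {(fst c \<times> fst d, map_prod (snd c) (snd d))})"
        unfolding prod_manifold_def manifold.simps by blast
      then show ?thesis by simp
    qed
    finally show ?thesis ..
  qed
  fix k assume "k \<in> atlas (prod_manifold M N)"
  then obtain c d where k: "k = (fst c \<times> fst d, map_prod (snd c) (snd d))"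
    and c: "c \<in> atlas M" and d: "d \<in> atlas N"
    by (auto simp: prod_manifold_def)
  have im: "snd k ` fst k = (snd c ` fst c) \<times> (snd d ` fst d)" by (auto simp: k)
  show "openin (mtop (prod_manifold M N)) (fst k)"
    using chart_domain_openin[OF M c] chart_domain_openin[OF N d]
    by (simp add: k prod_manifold_def openin_prod_Times_iff)
  show "open (snd k ` fst k)"
    using M N c d unfolding im by (intro open_Times) (auto simp: charted_def)
  have "homeomorphic_map (subtopology (mtop M) (fst c)) (top_of_set (snd c ` fst c)) (snd c)"
    "homeomorphic_map (subtopology (mtop N) (fst d)) (top_of_set (snd d ` fst d)) (snd d)"
    using M N c d by (auto simp: charted_def)
  then obtain c' d' where
    "homeomorphic_maps (subtopology (mtop M) (fst c)) (top_of_set (snd c ` fst c)) (snd c) c'"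
    "homeomorphic_maps (subtopology (mtop N) (fst d)) (top_of_set (snd d ` fst d)) (snd d) d'"
    unfolding homeomorphic_map_maps by blast
  \<comment> \<open>The deleted simp rule would merge the two Euclidean factors into one subtopology
    and hide the product form that \<open>homeomorphic_maps_prod\<close> matches.\<close>
  then have "homeomorphic_maps
      (prod_topology (subtopology (mtop M) (fst c)) (subtopology (mtop N) (fst d)))
      (prod_topology (top_of_set (snd c ` fst c)) (top_of_set (snd d ` fst d)))
      (\<lambda>(x, y). (snd c x, snd d y)) (\<lambda>(x, y). (c' x, d' y))"
    by (simp add: homeomorphic_maps_prod del: prod_topology_subtopology_eu)
  then show "homeomorphic_map (subtopology (mtop (prod_manifold M N)) (fst k))
      (top_of_set (snd k ` fst k)) (snd k)"
    unfolding homeomorphic_map_maps im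
    by (auto simp: k prod_manifold_def subtopology_Times map_prod_def)
qed

text \<open>The target chart \<open>e\<close> may differ from the factor \<open>c\<close> of the
  product chart, so in coordinates the projection is the linear projection followed by a chart
  change of \<open>M\<close>.\<close>

lemma smooth_map_fst:
  fixes M :: "('a, 'e::finite_dim_inner) manifold" and N :: "('b, 'f::finite_dim_inner) manifold"
  assumes M: "smooth_manifold M" and N: "smooth_manifold N"
  shows "smooth_map (prod_manifold M N) M fst"
  unfolding smooth_map_def
proof (intro conjI ballI)
  note chM = smooth_manifold_charted[OF M] and chN = smooth_manifold_charted[OF N]
  note ch = charted_prod_manifold[OF chM chN]
  have cont: "continuous_map (mtop (prod_manifold M N)) (mtop M) fst"
    by (simp add: prod_manifold_def continuous_map_fst)
  then show "continuous_map (mtop (prod_manifold M N)) (mtop M) fst" .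
  fix k e assume k_in: "k \<in> atlas (prod_manifold M N)" and e: "e \<in> atlas M"
  then obtain c d where k: "k = (fst c \<times> fst d, map_prod (snd c) (snd d))"
    and c: "c \<in> atlas M" and d: "d \<in> atlas N"
    by (auto simp: prod_manifold_def)
  let ?S = "snd k ` {x \<in> fst k. fst x \<in> fst e}"
  have S: "open ?S"
    using open_chart_preimage[OF ch k_in cont] chart_domain_openin[OF chM e] by blast
  have "smooth_on ?S (\<lambda>u. local_rep c e (\<lambda>x. x) (fst u))"
  proof (rule smooth_on_compose[OF S, where f = fst])
    show "fst ` ?S \<subseteq> rep_domain c e (\<lambda>x. x)" by (auto simp: k rep_domain_def)
    show "smooth_on ?S fst"
      by (intro smooth_on_bounded_linear[OF bounded_linear_fst] smooth_on_id S)
    show "smooth_on (rep_domain c e (\<lambda>x. x)) (local_rep c e (\<lambda>x. x))"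
      using smooth_map_local_rep[OF smooth_map_id[OF M] c e] .
  qed
  then show "smooth_on ?S (local_rep k e fst)"
  proof (rule smooth_on_cong[OF S])
    fix u assume "u \<in> ?S"
    then obtain z where z: "z \<in> fst k" "u = snd k z" by blast
    have "local_rep k e fst u = snd e (fst z)" unfolding z(2) by (rule local_rep_chart[OF ch k_in z(1)])
    then show "local_rep c e (\<lambda>x. x) (fst u) = local_rep k e fst u"
      using z by (auto simp: k local_rep_chart[OF chM c])
  qed
qed

lemma smooth_map_snd:
  fixes M :: "('a, 'e::finite_dim_inner) manifold" and N :: "('b, 'f::finite_dim_inner) manifold"
  assumes M: "smooth_manifold M" and N: "smooth_manifold N"
  shows "smooth_map (prod_manifold M N) N snd"
  unfolding smooth_map_def
proof (intro conjI ballI)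
  note chM = smooth_manifold_charted[OF M] and chN = smooth_manifold_charted[OF N]
  note ch = charted_prod_manifold[OF chM chN]
  have cont: "continuous_map (mtop (prod_manifold M N)) (mtop N) snd"
    by (simp add: prod_manifold_def continuous_map_snd)
  then show "continuous_map (mtop (prod_manifold M N)) (mtop N) snd" .
  fix k e assume k_in: "k \<in> atlas (prod_manifold M N)" and e: "e \<in> atlas N"
  then obtain c d where k: "k = (fst c \<times> fst d, map_prod (snd c) (snd d))"
    and c: "c \<in> atlas M" and d: "d \<in> atlas N"
    by (auto simp: prod_manifold_def)
  let ?S = "snd k ` {x \<in> fst k. snd x \<in> fst e}"
  have S: "open ?S"
    using open_chart_preimage[OF ch k_in cont] chart_domain_openin[OF chN e] by blast
  have "smooth_on ?S (\<lambda>u. local_rep d e (\<lambda>x. x) (snd u))"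
  proof (rule smooth_on_compose[OF S, where f = snd])
    show "snd ` ?S \<subseteq> rep_domain d e (\<lambda>x. x)" by (auto simp: k rep_domain_def)
    show "smooth_on ?S snd"
      by (intro smooth_on_bounded_linear[OF bounded_linear_snd] smooth_on_id S)
    show "smooth_on (rep_domain d e (\<lambda>x. x)) (local_rep d e (\<lambda>x. x))"
      using smooth_map_local_rep[OF smooth_map_id[OF N] d e] .
  qed
  then show "smooth_on ?S (local_rep k e snd)"
  proof (rule smooth_on_cong[OF S])
    fix u assume "u \<in> ?S"
    then obtain z where z: "z \<in> fst k" "u = snd k z" by blast
    have "local_rep k e snd u = snd e (snd z)" unfolding z(2) by (rule local_rep_chart[OF ch k_in z(1)])
    then show "local_rep d e (\<lambda>x. x) (snd u) = local_rep k e snd u"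
      using z by (auto simp: k local_rep_chart[OF chN d])
  qed
qed

lemma smooth_map_slice:
  fixes M :: "('a, 'e::finite_dim_inner) manifold" and N :: "('b, 'f::finite_dim_inner) manifold"
  assumes M: "smooth_manifold M" and N: "smooth_manifold N" and q: "q \<in> points N"
  shows "smooth_map M (prod_manifold M N) (\<lambda>x. (x, q))"
  unfolding smooth_map_def
proof (intro conjI ballI)
  note chM = smooth_manifold_charted[OF M] and chN = smooth_manifold_charted[OF N]
  note ch = charted_prod_manifold[OF chM chN]
  have cont: "continuous_map (mtop M) (mtop (prod_manifold M N)) (\<lambda>x. (x, q))"
    using q by (simp add: prod_manifold_def continuous_map_paired)
  then show "continuous_map (mtop M) (mtop (prod_manifold M N)) (\<lambda>x. (x, q))" .
  fix b k assume b: "b \<in> atlas M" and k_in: "k \<in> atlas (prod_manifold M N)"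
  then obtain c d where k: "k = (fst c \<times> fst d, map_prod (snd c) (snd d))"
    and c: "c \<in> atlas M" and d: "d \<in> atlas N"
    by (auto simp: prod_manifold_def)
  let ?S = "snd b ` {x \<in> fst b. (x, q) \<in> fst k}"
  have S: "open ?S"
    using open_chart_preimage[OF chM b cont] chart_domain_openin[OF ch k_in] by blast
  have "smooth_on ?S (local_rep b c (\<lambda>x. x))"
    using smooth_map_local_rep[OF smooth_map_id[OF M] b c]
    by (rule smooth_on_subset) (auto simp: k rep_domain_def)
  then have "smooth_on ?S (\<lambda>u. (local_rep b c (\<lambda>x. x) u, snd d q))"
    by (intro smooth_on_Pair smooth_on_const S)
  then show "smooth_on ?S (local_rep b k (\<lambda>x. (x, q)))"
    by (rule smooth_on_cong[OF S]) (auto simp: k local_rep_chart[OF chM b])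
qed

section \<open>Tangent maps and vector fields\<close>

lemma tangent_spaceD:
  assumes "v \<in> tangent_space M p"
  shows "fst v = p"
    and "c \<in> charts_at M p \<Longrightarrow> d \<in> charts_at M p \<Longrightarrow> snd v d = rep_deriv c d (\<lambda>x. x) p (snd v c)"
    and "c \<notin> charts_at M p \<Longrightarrow> snd v c = 0"
proof -
  obtain \<xi> where "v = (p, \<xi>)"
    and "\<forall>c\<in>charts_at M p. \<forall>d\<in>charts_at M p. \<xi> d = rep_deriv c d (\<lambda>x. x) p (\<xi> c)"
    and "\<forall>c. c \<notin> charts_at M p \<longrightarrow> \<xi> c = 0"
    using assms unfolding tangent_space_def by blast
  then show "fst v = p"
    and "c \<in> charts_at M p \<Longrightarrow> d \<in> charts_at M p \<Longrightarrow> snd v d = rep_deriv c d (\<lambda>x. x) p (snd v c)"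
    and "c \<notin> charts_at M p \<Longrightarrow> snd v c = 0"
    by (metis fst_conv snd_conv)+
qed

text \<open>One chart decides: compatibility determines the components in all other charts around
  \<open>p\<close>, and the remaining ones are 0 by convention.\<close>

lemma tangent_space_eqI:
  assumes "v \<in> tangent_space M p" "w \<in> tangent_space M p" "c \<in> charts_at M p" "snd v c = snd w c"
  shows "v = w"
proof (rule prod_eqI)
  show "fst v = fst w" using assms(1,2) tangent_spaceD(1) by metis
  show "snd v = snd w"
  proof
    fix d
    show "snd v d = snd w d"
      using tangent_spaceD(2)[OF assms(1,3), of d] tangent_spaceD(3)[OF assms(1), of d]
        tangent_spaceD(2)[OF assms(2,3), of d] tangent_spaceD(3)[OF assms(2), of d] assms(4)
      by (cases "d \<in> charts_at M p") simp_all
  qed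
qed

lemma fst_tangent_map [simp]: "fst (tangent_map M N f v) = f (fst v)"
  by (simp add: tangent_map_def Let_def)

text \<open>Frees \<open>tangent_map\<close> from its \<open>SOME\<close>: the chain rule through
  the change from the chosen chart \<open>b\<close> to \<open>c\<close> meets the compatibility of
  the components of \<open>v\<close>.\<close>

lemma snd_tangent_map:
  assumes M: "smooth_manifold M" and N: "charted N" and f: "smooth_map M N f"
    and v: "v \<in> tangent_space M p" and c: "c \<in> charts_at M p" and d: "d \<in> charts_at N (f p)"
  shows "snd (tangent_map M N f v) d = rep_deriv c d f p (snd v c)"
proof -
  define b where "b = (SOME c. c \<in> charts_at M p)"
  have b: "b \<in> charts_at M p" unfolding b_def using c by (rule someI)
  note M' = smooth_manifold_charted[OF M]
  have "snd (tangent_map M N f v) d = rep_deriv b d f p (snd v b)"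
    using d by (simp add: tangent_map_def Let_def tangent_spaceD(1)[OF v] b_def)
  also have "\<dots> = rep_deriv c d f p (rep_deriv b c (\<lambda>x. x) p (snd v b))"
    using rep_deriv_compose[OF M' M' smooth_map_id[OF M] f b c d] .
  also have "\<dots> = rep_deriv c d f p (snd v c)" using tangent_spaceD(2)[OF v b c] by simp
  finally show ?thesis .
qed

lemma tangent_map_in_tangent_space:
  assumes M: "smooth_manifold M" and N: "smooth_manifold N" and f: "smooth_map M N f"
    and p: "p \<in> points M" and v: "v \<in> tangent_space M p"
  shows "tangent_map M N f v \<in> tangent_space N (f p)"
proof -
  note M' = smooth_manifold_charted[OF M] and N' = smooth_manifold_charted[OF N]
  obtain c where c: "c \<in> charts_at M p" using chart_exists[OF M' p] by blast
  let ?w = "tangent_map M N f v"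
  have "snd ?w e = rep_deriv d e (\<lambda>x. x) (f p) (snd ?w d)"
    if d: "d \<in> charts_at N (f p)" and e: "e \<in> charts_at N (f p)" for d e
    using rep_deriv_compose[OF M' N' f smooth_map_id[OF N] c d e]
      snd_tangent_map[OF M N' f v c d] snd_tangent_map[OF M N' f v c e] by simp
  moreover have "snd ?w d = 0" if "d \<notin> charts_at N (f p)" for d
    using that by (simp add: tangent_map_def Let_def tangent_spaceD(1)[OF v])
  moreover have "?w = (f p, snd ?w)" by (simp add: prod_eq_iff tangent_spaceD(1)[OF v])
  ultimately show ?thesis unfolding tangent_space_def by blast
qed

section \<open>Smooth maps into the tangent bundle\<close>

lemma mem_tangent_chart_iff:
  assumes "v \<in> tangent_space M p"
  shows "v \<in> fst (tangent_chart M c) \<longleftrightarrow> p \<in> fst c"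
proof
  assume "v \<in> fst (tangent_chart M c)"
  then obtain q where "q \<in> fst c" "v \<in> tangent_space M q" by (auto simp: tangent_chart_def)
  then show "p \<in> fst c" using tangent_spaceD(1) assms by metis
qed (use assms in \<open>auto simp: tangent_chart_def\<close>)

text \<open>That the values are genuine tangent vectors is hidden in continuity: the points of a
  generated topology are those of its generators, which lie in the bundle charts.\<close>

lemma smooth_map_tangent_bundleD:
  assumes "smooth_map Q (tangent_bundle M) X" "q \<in> points Q"
  shows "X q \<in> tangent_space M (fst (X q))"
proof -
  have "X q \<in> points (tangent_bundle M)" using smooth_map_points[OF assms] .
  then obtain c p where "c \<in> atlas M" "p \<in> fst c" "X q \<in> tangent_space M p"
    by (auto simp: tangent_bundle_def tangent_chart_def)
  then show ?thesis using tangent_spaceD(1) by metis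
qed

lemma vector_field_tangent_space:
  assumes "vector_field M X" "p \<in> points M"
  shows "X p \<in> tangent_space M p"
  using smooth_map_tangent_bundleD[of M M X p] assms by (simp add: vector_field_def)

text \<open>The field in the chart \<open>c\<close>, as a map between model vectors. It is the
  right-hand side of the differential equation solved in
  \<open>integral_curve_through\<close>.\<close>

definition principal_part :: "('a, 'e) chart \<Rightarrow> ('a \<Rightarrow> ('a, 'e) tangent) \<Rightarrow> 'e \<Rightarrow> 'e" where
  "principal_part c X u = snd (X (inv_into (fst c) (snd c) u)) c"

lemma principal_part_chart:
  "charted M \<Longrightarrow> c \<in> atlas M \<Longrightarrow> p \<in> fst c \<Longrightarrow> principal_part c X (snd c p) = snd (X p) c"
  using chart_inj[of M c] by (simp add: principal_part_def)

lemma smooth_principal_part: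
  assumes M: "charted M" and X: "vector_field M X" and c: "c \<in> atlas M"
  shows "smooth_on (snd c ` fst c) (principal_part c X)"
proof -
  have "tangent_chart M c \<in> atlas (tangent_bundle M)" using c by (simp add: tangent_bundle_def)
  then have "smooth_on (rep_domain c (tangent_chart M c) X) (local_rep c (tangent_chart M c) X)"
    using smooth_map_local_rep[of M "tangent_bundle M" X] X c by (simp add: vector_field_def)
  moreover have "rep_domain c (tangent_chart M c) X = snd c ` fst c"
    unfolding rep_domain_def
    using mem_tangent_chart_iff[OF vector_field_tangent_space[OF X], where c = c]
      chart_domain_subset[OF M c] by (intro arg_cong2[where f = image]) auto
  ultimately have "smooth_on (snd c ` fst c) (\<lambda>u. snd (local_rep c (tangent_chart M c) X u))"
    by (intro smooth_on_bounded_linear[OF bounded_linear_snd] chart_range_open[OF M c]) simp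
  then show ?thesis
    by (rule smooth_on_cong[OF chart_range_open[OF M c]])
      (simp add: local_rep_def tangent_chart_def principal_part_def)
qed

text \<open>Smooth foot points and smooth components suffice. Continuity comes from the same data:
  generators of the bundle topology are preimages of open sets under bundle charts, so their
  preimages in \<open>Q\<close> can be tested chart by chart.\<close>

lemma smooth_map_tangent_bundleI:
  fixes Q :: "('q, 'f::finite_dim_inner) manifold" and M :: "('m, 'e::finite_dim_inner) manifold"
  assumes Q: "charted Q" and M: "charted M" and f: "smooth_map Q M f"
    and X: "\<And>q. q \<in> points Q \<Longrightarrow> X q \<in> tangent_space M (f q)"
    and smooth: "\<And>c e. c \<in> atlas Q \<Longrightarrow> e \<in> atlas M \<Longrightarrow>
      smooth_on (rep_domain c e f) (\<lambda>u. snd (X (inv_into (fst c) (snd c) u)) e)"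
  shows "smooth_map Q (tangent_bundle M) X"
proof -
  have rep_smooth: "smooth_on (rep_domain c e f) (local_rep c (tangent_chart M e) X)"
    if c: "c \<in> atlas Q" and e: "e \<in> atlas M" for c e
  proof (rule smooth_on_cong)
    show op: "open (rep_domain c e f)" using open_rep_domain[OF Q M f c e] .
    show "smooth_on (rep_domain c e f)
        (\<lambda>u. (local_rep c e f u, snd (X (inv_into (fst c) (snd c) u)) e))"
      by (rule smooth_on_Pair[OF op smooth_map_local_rep[OF f c e] smooth[OF c e]])
    fix u assume "u \<in> rep_domain c e f"
    then obtain x where x: "x \<in> fst c" "u = snd c x" by (auto simp: rep_domain_def)
    have "fst (X x) = f x" using tangent_spaceD(1)[OF X] x(1) chart_domain_subset[OF Q c] by blast
    then show "(local_rep c e f u, snd (X (inv_into (fst c) (snd c) u)) e)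
        = local_rep c (tangent_chart M e) X u"
      using x chart_inj[OF Q c] by (simp add: local_rep_def tangent_chart_def)
  qed
  have dom: "x \<in> points Q \<and> (X x \<in> fst (tangent_chart M e) \<longleftrightarrow> f x \<in> fst e)"
    if "c \<in> atlas Q" "x \<in> fst c" for c x e
    using that chart_domain_subset[OF Q that(1)] mem_tangent_chart_iff[OF X] by blast
  have dom_eq: "snd c ` {x \<in> fst c. X x \<in> fst (tangent_chart M e)} = rep_domain c e f"
    if "c \<in> atlas Q" for c e
    unfolding rep_domain_def using dom[OF that, where e = e] by (intro arg_cong2[where f = image]) auto
  have "continuous_map (mtop Q) (mtop (tangent_bundle M)) X"
    unfolding tangent_bundle_def manifold.simps
  proof (rule continuous_on_generated_topo)
    let ?U = "\<lambda>e W. fst (tangent_chart M e) \<inter> snd (tangent_chart M e) -` W"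
    fix U assume "U \<in> {?U e W |e W. e \<in> atlas M \<and> open W}"
    then obtain e W where U: "U = ?U e W" and e: "e \<in> atlas M" and W: "open W" by blast
    define V where "V c = rep_domain c e f \<inter> local_rep c (tangent_chart M e) X -` W"
      for c :: "('q, 'f) chart"
    have V: "open (V c)" if "c \<in> atlas Q" for c
      unfolding V_def
      using continuous_open_preimage[OF smooth_on_continuous[OF rep_smooth[OF that e]]
          open_rep_domain[OF Q M f that e] W] .
    have V_eq: "snd c x \<in> V c \<longleftrightarrow> X x \<in> U" if c: "c \<in> atlas Q" and x: "x \<in> fst c" for c x
    proof -
      have "snd c x \<in> rep_domain c e f \<longleftrightarrow> f x \<in> fst e"
        using x chart_inj[OF Q c] by (auto simp: rep_domain_def inj_on_def)
      then show ?thesis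
        using dom[OF c x, of e] local_rep_chart[OF Q c x, of "tangent_chart M e" X] by (auto simp: V_def U)
    qed
    have "X -` U \<inter> points Q = (\<Union>c\<in>atlas Q. {x \<in> fst c. snd c x \<in> V c})"
    proof (intro equalityI subsetI)
      fix x assume x: "x \<in> X -` U \<inter> points Q"
      then obtain c where "c \<in> atlas Q" "x \<in> fst c"
        using chart_exists[OF Q, of x] by (auto simp: charts_at_def)
      then show "x \<in> (\<Union>c\<in>atlas Q. {x \<in> fst c. snd c x \<in> V c})" using V_eq x by blast
    next
      fix x assume "x \<in> (\<Union>c\<in>atlas Q. {x \<in> fst c. snd c x \<in> V c})"
      then obtain c where c: "c \<in> atlas Q" "x \<in> fst c" "snd c x \<in> V c" by blast
      then show "x \<in> X -` U \<inter> points Q" using V_eq[OF c(1,2)] dom[OF c(1,2)] by blast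
    qed
    then show "openin (mtop Q) (X -` U \<inter> points Q)"
      using chart_open_vimage[OF Q _ V] by auto
  next
    show "X ` points Q \<subseteq> \<Union> {fst (tangent_chart M e) \<inter> snd (tangent_chart M e) -` W |e W.
        e \<in> atlas M \<and> open W}"
    proof (rule image_subsetI)
      fix x assume x: "x \<in> points Q"
      obtain e where e: "e \<in> atlas M" "f x \<in> fst e"
        using chart_exists[OF M smooth_map_points[OF f x]] by (auto simp: charts_at_def)
      then have "X x \<in> fst (tangent_chart M e) \<inter> snd (tangent_chart M e) -` UNIV"
        using mem_tangent_chart_iff[OF X[OF x]] by blast
      then show "X x \<in> \<Union> {fst (tangent_chart M e) \<inter> snd (tangent_chart M e) -` W |e W.
          e \<in> atlas M \<and> open W}"
        using e(1) open_UNIV by blast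
    qed
  qed
  then show ?thesis
    unfolding smooth_map_def using rep_smooth dom_eq by (auto simp: tangent_bundle_def)
qed

text \<open>Applied to alpha on M x N and to each alpha_q on M. In coordinates the map is the
  derivative of \<open>g\<close> applied to the principal part of \<open>Z\<close>, both evaluated
  along \<open>a\<close>; the intermediate chart \<open>d\<close> of \<open>P\<close> is available
  only near a given point.\<close>

lemma smooth_map_tangent_map_field:
  assumes Q: "charted Q" and P: "smooth_manifold P" and M: "smooth_manifold M"
    and a: "smooth_map Q P a" and Z: "vector_field P Z" and g: "smooth_map P M g"
  shows "smooth_map Q (tangent_bundle M) (\<lambda>q. tangent_map P M g (Z (a q)))"
proof (rule smooth_map_tangent_bundleI[OF Q])
  note P' = smooth_manifold_charted[OF P] and M' = smooth_manifold_charted[OF M]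
  note Zp = vector_field_tangent_space[OF Z]
  show "charted M" by (rule M')
  show ga: "smooth_map Q M (\<lambda>q. g (a q))"
    using smooth_map_compose[OF Q P' chart_domain_openin[OF M'] a g] .
  show "tangent_map P M g (Z (a q)) \<in> tangent_space M (g (a q))" if "q \<in> points Q" for q
    using tangent_map_in_tangent_space[OF P M g] Zp smooth_map_points[OF a that] by blast
  fix c e assume c: "c \<in> atlas Q" and e: "e \<in> atlas M"
  let ?X = "\<lambda>u. snd (tangent_map P M g (Z (a (inv_into (fst c) (snd c) u)))) e"
  show "smooth_on (rep_domain c e (\<lambda>q. g (a q))) ?X"
  proof (rule smooth_on_local)
    fix u assume "u \<in> rep_domain c e (\<lambda>q. g (a q))"
    then obtain q where q: "q \<in> fst c" "g (a q) \<in> fst e" "u = snd c q" by (auto simp: rep_domain_def)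
    have "a q \<in> points P" using smooth_map_points[OF a] chart_domain_subset[OF Q c] q(1) by blast
    then obtain d where d: "d \<in> atlas P" "a q \<in> fst d"
      using chart_exists[OF P', of "a q"] by (auto simp: charts_at_def)
    define T where "T = rep_domain c d a \<inter> rep_domain c e (\<lambda>q. g (a q))"
    have T: "open T"
      unfolding T_def using open_rep_domain[OF Q P' a c d(1)] open_rep_domain[OF Q M' ga c e] by blast
    have T_eq: "T = snd c ` {q \<in> fst c. a q \<in> fst d \<and> g (a q) \<in> fst e}"
      using chart_inj[OF Q c] by (auto simp: T_def rep_domain_def inj_on_def)
    have rep: "local_rep c d a (snd c q) = snd d (a q)" if "q \<in> fst c" for q
      using local_rep_chart[OF Q c that] .
    have a_smooth: "smooth_on T (local_rep c d a)"
      using smooth_map_local_rep[OF a c d(1)] by (rule smooth_on_subset) (simp add: T_def)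
    have "smooth_on T (\<lambda>u. principal_part d Z (local_rep c d a u))"
      by (rule smooth_on_compose[OF T _ a_smooth smooth_principal_part[OF P' Z d(1)]])
        (auto simp: T_eq rep)
    moreover have "local_rep c d a ` T \<subseteq> rep_domain d e g" by (auto simp: T_eq rep rep_domain_def)
    ultimately have "smooth_on T (\<lambda>u. frechet_derivative (local_rep d e g) (at (local_rep c d a u))
        (principal_part d Z (local_rep c d a u)))"
      using a_smooth smooth_map_local_rep[OF g d(1) e] by (intro smooth_on_derivative_apply[OF T])
    then have "smooth_on T ?X"
    proof (rule smooth_on_cong[OF T])
      fix u assume "u \<in> T"
      then obtain q where q: "q \<in> fst c" "a q \<in> fst d" "g (a q) \<in> fst e" "u = snd c q"
        by (auto simp: T_eq)
      have "a q \<in> points P" using smooth_map_points[OF a] chart_domain_subset[OF Q c] q(1) by blast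
      then show "frechet_derivative (local_rep d e g) (at (local_rep c d a u))
          (principal_part d Z (local_rep c d a u)) = ?X u"
        using snd_tangent_map[OF P M' g Zp charts_atI[OF d(1) q(2)] charts_atI[OF e q(3)]]
          q chart_inj[OF Q c] by (simp add: rep principal_part_chart[OF P' d(1)])
    qed
    moreover have "u \<in> T" using q d by (auto simp: T_eq)
    ultimately show "\<exists>T. open T \<and> u \<in> T \<and> smooth_on T ?X" using T by blast
  qed
qed

section \<open>Integral curves\<close>

lemma interval_manifold_simps [simp]:
  "mtop (interval_manifold I) = top_of_set I" "atlas (interval_manifold I) = {(I, \<lambda>t. t)}"
  by (simp_all add: interval_manifold_def)

lemma charts_at_interval: "t \<in> I \<Longrightarrow> charts_at (interval_manifold I) t = {(I, \<lambda>t. t)}"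
  by (auto simp: charts_at_def)

lemma charted_interval_manifold: "open I \<Longrightarrow> charted (interval_manifold I)"
  by (simp add: charted_def subtopology_subtopology flip: id_def)

lemma local_rep_interval: "t \<in> I \<Longrightarrow> local_rep (I, \<lambda>t. t) d f t = snd d (f t)"
  using inv_into_f_f[of "\<lambda>t. t" I t] by (simp add: local_rep_def)

lemma tangent_map_unit_field:
  assumes "t \<in> I"
  shows "tangent_map (interval_manifold I) P \<zeta> (unit_field I t) = (\<zeta> t, \<lambda>d. if d \<in> charts_at P (\<zeta> t)
      then frechet_derivative (local_rep (I, \<lambda>t. t) d \<zeta>) (at t) 1 else 0)"
  using assms by (auto simp: tangent_map_def unit_field_def Let_def charts_at_interval)

lemma rep_domain_interval: "rep_domain (I, \<lambda>t. t) d f = {t \<in> I. f t \<in> fst d}"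
  by (simp add: rep_domain_def)

lemma integral_curve_velocity:
  assumes P: "charted P" and \<zeta>: "integral_curve P Z I \<zeta>" and t: "t \<in> I"
    and d: "d \<in> charts_at P (\<zeta> t)"
  shows "((\<lambda>s. snd d (\<zeta> s)) has_vector_derivative snd (Z (\<zeta> t)) d) (at t)"
proof -
  let ?k = "(I, \<lambda>t. t) :: (real, real) chart"
  have I: "open I" and smooth: "smooth_map (interval_manifold I) P \<zeta>"
    and eq: "tangent_map (interval_manifold I) P \<zeta> (unit_field I t) = Z (\<zeta> t)"
    using \<zeta> t by (auto simp: integral_curve_def)
  have "?k \<in> charts_at (interval_manifold I) t" using t by (simp add: charts_at_interval)
  then have D: "(local_rep ?k d \<zeta> has_derivative frechet_derivative (local_rep ?k d \<zeta>) (at t)) (at t)"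
    using local_rep_has_derivative[OF smooth _ d, of ?k] by simp
  have "frechet_derivative (local_rep ?k d \<zeta>) (at t) 1 = snd (Z (\<zeta> t)) d"
    using d by (simp add: eq[symmetric] tangent_map_unit_field[OF t])
  \<comment> \<open>A linear map on the reals is determined by its value at 1, and that value is all
    the integral curve equation provides.\<close>
  then have "frechet_derivative (local_rep ?k d \<zeta>) (at t) s = s *\<^sub>R snd (Z (\<zeta> t)) d" for s
    using linear_scale[OF has_derivative_linear[OF D], of s 1] by simp
  then have "frechet_derivative (local_rep ?k d \<zeta>) (at t) = (\<lambda>s. s *\<^sub>R snd (Z (\<zeta> t)) d)" ..
  then have "(local_rep ?k d \<zeta> has_vector_derivative snd (Z (\<zeta> t)) d) (at t)"
    using D by (simp add: has_vector_derivative_def)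
  then show ?thesis
    by (rule has_vector_derivative_transform_within_open[OF _ I t]) (simp add: local_rep_interval)
qed

text \<open>The differential equation is solved in one chart \<open>c\<close> and transported by the
  inverse chart. Smoothness and the integral curve equation must nevertheless hold in every chart
  \<open>d\<close>; chart changes carry them over.\<close>

lemma integral_curve_through:
  assumes P: "smooth_manifold P" and Z: "vector_field P Z" and p: "p \<in> points P"
  obtains e \<zeta> where "0 < e" "integral_curve P Z {-e<..<e} \<zeta>" "\<zeta> 0 = p"
proof -
  note P' = smooth_manifold_charted[OF P]
  obtain c where c: "c \<in> atlas P" "p \<in> fst c"
    using chart_exists[OF P' p] by (auto simp: charts_at_def)
  obtain e y where e: "0 < e" and y0: "y 0 = snd c p" and yU: "y ` {-e<..<e} \<subseteq> snd c ` fst c"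
    and y_smooth: "smooth_on {-e<..<e} y"
    and y': "\<And>t. t \<in> {-e<..<e} \<Longrightarrow> (y has_vector_derivative principal_part c Z (y t)) (at t)"
    using smooth_ode_solution[OF chart_range_open[OF P' c(1)] imageI[OF c(2)]
        smooth_principal_part[OF P' Z c(1)]] by blast
  define I where "I = {-e<..<e}"
  have I: "open I" by (simp add: I_def)
  define \<zeta> where "\<zeta> t = inv_into (fst c) (snd c) (y t)" for t
  have \<zeta>: "\<zeta> t \<in> fst c" "snd c (\<zeta> t) = y t" if "t \<in> I" for t
  proof -
    have "y t \<in> snd c ` fst c" using yU that by (auto simp: I_def)
    then show "\<zeta> t \<in> fst c" "snd c (\<zeta> t) = y t"
      unfolding \<zeta>_def by (rule inv_into_into, rule f_inv_into_f)
  qed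
  \<comment> \<open>Preimages under \<open>\<zeta>\<close> become preimages under \<open>y\<close>,
    so that openness of the chart \<open>c\<close> yields continuity of
    \<open>\<zeta>\<close>.\<close>
  have preim: "{t \<in> I. \<zeta> t \<in> V} = I \<inter> y -` (snd c ` (fst c \<inter> V))" for V
  proof -
    have "\<zeta> t \<in> V \<longleftrightarrow> y t \<in> snd c ` (fst c \<inter> V)" if "t \<in> I" for t
      using inj_on_image_mem_iff[OF chart_inj[OF P' c(1)] \<zeta>(1)[OF that], of "fst c \<inter> V"]
        \<zeta>[OF that] by simp
    then show ?thesis by blast
  qed
  have cont: "continuous_map (mtop (interval_manifold I)) (mtop P) \<zeta>"
    unfolding continuous_map_def
  proof (intro conjI allI impI)
    show "\<zeta> \<in> points (interval_manifold I) \<rightarrow> points P"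
      using \<zeta>(1) chart_domain_subset[OF P' c(1)] by auto
    fix V assume V: "openin (mtop P) V"
    then have "open (snd c ` (fst c \<inter> V))"
      by (intro chart_open_image[OF P' c(1)]) (auto intro: chart_domain_openin[OF P' c(1)])
    then have "openin (top_of_set I) (I \<inter> y -` (snd c ` (fst c \<inter> V)))"
      using smooth_on_continuous[OF y_smooth] by (intro continuous_openin_preimage_gen) (simp_all add: I_def)
    then show "openin (mtop (interval_manifold I)) {t \<in> points (interval_manifold I). \<zeta> t \<in> V}"
      using preim[of V] by simp
  qed
  have rep: "open {t \<in> I. \<zeta> t \<in> fst d}" "y ` {t \<in> I. \<zeta> t \<in> fst d} \<subseteq> rep_domain c d (\<lambda>x. x)"
    "\<And>t. t \<in> I \<Longrightarrow> local_rep (I, \<lambda>t. t) d \<zeta> t = local_rep c d (\<lambda>x. x) (y t)"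
    if d: "d \<in> atlas P" for d
  proof -
    show "open {t \<in> I. \<zeta> t \<in> fst d}"
      using open_chart_preimage[OF charted_interval_manifold[OF I] _ cont chart_domain_openin[OF P' d]]
      by simp
    show "y ` {t \<in> I. \<zeta> t \<in> fst d} \<subseteq> rep_domain c d (\<lambda>x. x)"
      using \<zeta> by (force simp: rep_domain_def)
    show "local_rep (I, \<lambda>t. t) d \<zeta> t = local_rep c d (\<lambda>x. x) (y t)" if "t \<in> I" for t
      using local_rep_chart[OF P' c(1) \<zeta>(1)[OF that], of d "\<lambda>x. x"] \<zeta>(2)[OF that] by (simp add: local_rep_interval that)
  qed
  have "smooth_map (interval_manifold I) P \<zeta>"
    unfolding smooth_map_def
  proof (intro conjI cont ballI)
    fix k d assume k: "k \<in> atlas (interval_manifold I)" and d: "d \<in> atlas P"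
    let ?S = "{t \<in> I. \<zeta> t \<in> fst d}"
    have "smooth_on ?S (\<lambda>t. local_rep c d (\<lambda>x. x) (y t))"
      using y_smooth
      by (intro smooth_on_compose[OF rep(1)[OF d] rep(2)[OF d] _
            smooth_map_local_rep[OF smooth_map_id[OF P] c(1) d]])
        (auto simp: I_def intro: smooth_on_subset)
    then have "smooth_on ?S (local_rep (I, \<lambda>t. t) d \<zeta>)"
      by (rule smooth_on_cong[OF rep(1)[OF d]]) (simp add: rep(3)[OF d])
    then show "smooth_on (snd k ` {x \<in> fst k. \<zeta> x \<in> fst d}) (local_rep k d \<zeta>)"
      using k by simp
  qed
  moreover have "tangent_map (interval_manifold I) P \<zeta> (unit_field I t) = Z (\<zeta> t)" if t: "t \<in> I" for t
  proof -
    have c_at: "c \<in> charts_at P (\<zeta> t)" using c \<zeta>(1)[OF t] by (simp add: charts_at_def)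
    have Zt: "Z (\<zeta> t) \<in> tangent_space P (\<zeta> t)"
      using vector_field_tangent_space[OF Z charts_at_points[OF P' c_at]] .
    \<comment> \<open>Differentiate the chart change from \<open>c\<close> to \<open>d\<close> along
      \<open>y\<close>; compatibility of the tangent vector \<open>Z (\<zeta> t)\<close> turns the
      result into its component in \<open>d\<close>.\<close>
    have "frechet_derivative (local_rep (I, \<lambda>t. t) d \<zeta>) (at t) 1 = snd (Z (\<zeta> t)) d"
      if d_at: "d \<in> charts_at P (\<zeta> t)" for d
    proof -
      have d: "d \<in> atlas P" "\<zeta> t \<in> fst d" using d_at by (auto simp: charts_at_def)
      have "(local_rep c d (\<lambda>x. x) has_derivative rep_deriv c d (\<lambda>x. x) (\<zeta> t)) (at (y t))"
        using local_rep_has_derivative[OF smooth_map_id[OF P] c_at d_at] \<zeta>(2)[OF t] by simp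
      moreover have "(y has_derivative (\<lambda>s. s *\<^sub>R snd (Z (\<zeta> t)) c)) (at t)"
        using y'[of t] t principal_part_chart[OF P' c(1) \<zeta>(1)[OF t], of Z] \<zeta>(2)[OF t]
        by (simp add: has_vector_derivative_def I_def)
      ultimately have "((\<lambda>t. local_rep c d (\<lambda>x. x) (y t)) has_derivative
          (\<lambda>s. rep_deriv c d (\<lambda>x. x) (\<zeta> t) (s *\<^sub>R snd (Z (\<zeta> t)) c))) (at t)"
        by (metis has_derivative_compose)
      then have "(local_rep (I, \<lambda>t. t) d \<zeta> has_derivative
          (\<lambda>s. rep_deriv c d (\<lambda>x. x) (\<zeta> t) (s *\<^sub>R snd (Z (\<zeta> t)) c))) (at t)"
        by (rule has_derivative_transform_within_open[OF _ I t]) (simp add: rep(3)[OF d(1)])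
      then have "frechet_derivative (local_rep (I, \<lambda>t. t) d \<zeta>) (at t) 1
          = rep_deriv c d (\<lambda>x. x) (\<zeta> t) (snd (Z (\<zeta> t)) c)"
        by (simp flip: frechet_derivative_at)
      then show ?thesis using tangent_spaceD(2)[OF Zt c_at d_at] by simp
    qed
    \<comment> \<open>Outside the charts at \<open>\<zeta> t\<close> both families vanish by
      convention.\<close>
    then have "(\<lambda>d. if d \<in> charts_at P (\<zeta> t)
        then frechet_derivative (local_rep (I, \<lambda>t. t) d \<zeta>) (at t) 1 else 0) = snd (Z (\<zeta> t))"
      using tangent_spaceD(3)[OF Zt] by (auto simp: fun_eq_iff)
    then show ?thesis
      using tangent_spaceD(1)[OF Zt] by (simp add: tangent_map_unit_field[OF t] prod_eq_iff)
  qed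
  ultimately have "integral_curve P Z I \<zeta>"
    using I by (simp add: integral_curve_def I_def is_interval_oo)
  moreover have "\<zeta> 0 = p" using c chart_inj[OF P' c(1)] by (simp add: \<zeta>_def y0)
  ultimately show ?thesis using that e unfolding I_def by blast
qed

section \<open>Constants of the motion\<close>

lemma integral_curve_image_velocity:
  assumes P: "charted P" and N: "charted N" and F: "smooth_map P N F"
    and \<zeta>: "integral_curve P Z I \<zeta>" and t: "t \<in> I"
    and c: "c \<in> charts_at P (\<zeta> t)" and d: "d \<in> charts_at N (F (\<zeta> t))"
  shows "((\<lambda>s. snd d (F (\<zeta> s))) has_vector_derivative rep_deriv c d F (\<zeta> t) (snd (Z (\<zeta> t)) c)) (at t)"
proof -
  have c': "c \<in> atlas P" "\<zeta> t \<in> fst c" using c by (auto simp: charts_at_def)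
  have I: "open I" and smooth: "smooth_map (interval_manifold I) P \<zeta>"
    using \<zeta> by (auto simp: integral_curve_def)
  have op: "open {s \<in> I. \<zeta> s \<in> fst c}"
    using open_rep_domain[OF charted_interval_manifold[OF I] P smooth, of "(I, \<lambda>t. t)" c] c'
    by (simp add: rep_domain_interval)
  have D: "(local_rep c d F has_derivative rep_deriv c d F (\<zeta> t)) (at (snd c (\<zeta> t)))"
    using local_rep_has_derivative[OF F c d] .
  have "((\<lambda>s. local_rep c d F (snd c (\<zeta> s))) has_derivative
      (\<lambda>s. rep_deriv c d F (\<zeta> t) (s *\<^sub>R snd (Z (\<zeta> t)) c))) (at t)"
    using has_derivative_compose[OF integral_curve_velocity[OF P \<zeta> t c, unfolded has_vector_derivative_def] D] .
  then have "((\<lambda>s. local_rep c d F (snd c (\<zeta> s))) has_vector_derivative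
      rep_deriv c d F (\<zeta> t) (snd (Z (\<zeta> t)) c)) (at t)"
    using linear_scale[OF has_derivative_linear[OF D]] by (simp add: has_vector_derivative_def)
  then show ?thesis
    by (rule has_vector_derivative_transform_within_open[OF _ op])
      (use t c' in \<open>auto simp: local_rep_chart[OF P c'(1)]\<close>)
qed

text \<open>The condition TF o Z = 0 in terms of principal parts, which spares naming the zero
  vectors of the tangent bundle of \<open>N\<close>.\<close>

definition annihilates ::
    "('p, 'e::finite_dim_inner) manifold \<Rightarrow> ('p \<Rightarrow> ('p, 'e) tangent) \<Rightarrow>
      ('n, 'g::finite_dim_inner) manifold \<Rightarrow> ('p \<Rightarrow> 'n) \<Rightarrow> bool" where
  "annihilates P Z N F \<longleftrightarrow> (\<forall>p\<in>points P. \<forall>c\<in>charts_at P p. \<forall>d\<in>charts_at N (F p).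
    rep_deriv c d F p (snd (Z p) c) = 0)"

lemma constant_of_motion_iff_annihilates:
  assumes P: "smooth_manifold P" and N: "smooth_manifold N" and Z: "vector_field P Z"
    and F: "smooth_map P N F"
  shows "constant_of_motion P Z N F \<longleftrightarrow> annihilates P Z N F"
proof
  note P' = smooth_manifold_charted[OF P] and N' = smooth_manifold_charted[OF N]
  assume const: "constant_of_motion P Z N F"
  show "annihilates P Z N F"
    unfolding annihilates_def
  proof (intro ballI)
    fix p c d assume p: "p \<in> points P" and c: "c \<in> charts_at P p" and d: "d \<in> charts_at N (F p)"
    obtain e \<zeta> where e: "0 < e" and \<zeta>: "integral_curve P Z {-e<..<e} \<zeta>" and \<zeta>0: "\<zeta> 0 = p"
      using integral_curve_through[OF P Z p] .
    have 0: "0 \<in> {-e<..<e}" using e by simp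
    have "(F \<circ> \<zeta>) constant_on {-e<..<e}" using const \<zeta> by (auto simp: constant_of_motion_def)
    then have F\<zeta>: "F (\<zeta> s) = F p" if "s \<in> {-e<..<e}" for s
      using that 0 \<zeta>0 unfolding constant_on_def o_def by metis
    \<comment> \<open>The derivative at time 0 is computed twice: by the chain rule and from the
      constancy of F along the curve.\<close>
    have "((\<lambda>s. snd d (F (\<zeta> s))) has_vector_derivative rep_deriv c d F p (snd (Z p) c)) (at 0)"
      using integral_curve_image_velocity[OF P' N' F \<zeta> 0] c d \<zeta>0 by simp
    moreover have "((\<lambda>s. snd d (F (\<zeta> s))) has_vector_derivative 0) (at 0)"
      by (rule has_vector_derivative_transform_within_open
          [OF has_vector_derivative_const[of "snd d (F p)"] open_greaterThanLessThan 0])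
        (simp add: F\<zeta>)
    ultimately show "rep_deriv c d F p (snd (Z p) c) = 0" by (rule vector_derivative_unique_at)
  qed
next
  note P' = smooth_manifold_charted[OF P] and N' = smooth_manifold_charted[OF N]
  assume ann: "annihilates P Z N F"
  \<comment> \<open>Vanishing velocity gives constancy only while the image stays in one chart of
    \<open>N\<close>, hence the local statement, combined with connectedness of
    \<open>I\<close>.\<close>
  have "(F \<circ> \<zeta>) constant_on I" if \<zeta>: "integral_curve P Z I \<zeta>" for I \<zeta>
  proof (rule locally_constant_imp_constant)
    have I: "open I" "is_interval I" and smooth: "smooth_map (interval_manifold I) P \<zeta>"
      using \<zeta> by (auto simp: integral_curve_def)
    show "connected I" using I(2) is_interval_connected by blast
    fix a assume a: "a \<in> I"
    have pts: "\<zeta> t \<in> points P" if "t \<in> I" for t using smooth_map_points[OF smooth] that by simp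
    obtain d where d: "d \<in> atlas N" "F (\<zeta> a) \<in> fst d"
      using chart_exists[OF N' smooth_map_points[OF F pts[OF a]]] by (auto simp: charts_at_def)
    have "smooth_map (interval_manifold I) N (\<lambda>t. F (\<zeta> t))"
      using smooth_map_compose[OF charted_interval_manifold[OF I(1)] P' chart_domain_openin[OF N'] smooth F] .
    then have "open {t \<in> I. F (\<zeta> t) \<in> fst d}"
      using open_rep_domain[OF charted_interval_manifold[OF I(1)] N', of _ "(I, \<lambda>t. t)" d] d(1)
      by (simp add: rep_domain_interval)
    then obtain r where r: "0 < r" "ball a r \<subseteq> {t \<in> I. F (\<zeta> t) \<in> fst d}"
      using a d(2) by (metis (mono_tags, lifting) mem_Collect_eq open_contains_ball)
    have "((\<lambda>s. snd d (F (\<zeta> s))) has_vector_derivative 0) (at t within ball a r)" if "t \<in> ball a r" for t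
    proof -
      have t: "t \<in> I" "F (\<zeta> t) \<in> fst d" using r(2) that by auto
      obtain c where c: "c \<in> charts_at P (\<zeta> t)" using chart_exists[OF P' pts[OF t(1)]] by blast
      have d_at: "d \<in> charts_at N (F (\<zeta> t))" using d(1) t(2) by (rule charts_atI)
      have "rep_deriv c d F (\<zeta> t) (snd (Z (\<zeta> t)) c) = 0"
        using ann pts[OF t(1)] c d_at by (simp add: annihilates_def)
      then show ?thesis
        using integral_curve_image_velocity[OF P' N' F \<zeta> t(1) c d_at]
        by (simp add: has_vector_derivative_at_within)
    qed
    then obtain k where "\<And>t. t \<in> ball a r \<Longrightarrow> snd d (F (\<zeta> t)) = k"
      using has_vector_derivative_zero_constant[OF convex_ball, of a r "\<lambda>s. snd d (F (\<zeta> s))"] by blast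
    then have "snd d (F (\<zeta> t)) = snd d (F (\<zeta> a))" if "t \<in> ball a r" for t
      using that r(1) by simp
    \<comment> \<open>Equal coordinates give equal points because a chart is injective and the ball
      was chosen so that F o zeta stays in its domain.\<close>
    then have "(F \<circ> \<zeta>) t = (F \<circ> \<zeta>) a" if "t \<in> ball a r" for t
      using inj_onD[OF chart_inj[OF N' d(1)], of "F (\<zeta> t)" "F (\<zeta> a)"] that r(2) d(2) by auto
    moreover have "openin (top_of_set I) (ball a r)"
      using r(2) by (intro openin_open_subtopology[THEN iffD2]) (auto simp: I)
    moreover have "a \<in> ball a r" using r(1) by simp
    ultimately show "\<exists>T. openin (top_of_set I) T \<and> a \<in> T \<and> (\<forall>x\<in>T. (F \<circ> \<zeta>) x = (F \<circ> \<zeta>) a)"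
      by blast
  qed
  then show "constant_of_motion P Z N F" using F by (simp add: constant_of_motion_def)
qed

section \<open>Complete slicings by diffeomorphisms\<close>

theorem theorem2:
  fixes P :: "('p, 'e::finite_dim_inner) manifold"
    and M :: "('m, 'f::finite_dim_inner) manifold"
    and N :: "('n, 'g::finite_dim_inner) manifold"
    and Z :: "'p \<Rightarrow> ('p, 'e) tangent"
    and \<alpha> :: "'m \<times> 'n \<Rightarrow> 'p"
  assumes "smooth_manifold P" and "smooth_manifold M" and "smooth_manifold N"
    and "vector_field P Z"
    and "diffeomorphism (prod_manifold M N) P \<alpha>"
  shows "is_complete_slicing P Z M N \<alpha> \<longleftrightarrow>
    constant_of_motion P Z N (snd \<circ> inv_into (points (prod_manifold M N)) \<alpha>)"
proof -
  note P = assms(1) and M = assms(2) and N = assms(3) and Z = assms(4)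
  note P' = smooth_manifold_charted[OF P] and M' = smooth_manifold_charted[OF M]
    and N' = smooth_manifold_charted[OF N]
  note MN' = charted_prod_manifold[OF M' N']
  define \<beta> where "\<beta> = inv_into (points (prod_manifold M N)) \<alpha>"
  define G where "G p = fst (\<beta> p)" for p
  define F where "F p = snd (\<beta> p)" for p
  have pts: "points (prod_manifold M N) = points M \<times> points N" by (simp add: prod_manifold_def)
  have bij: "bij_betw \<alpha> (points M \<times> points N) (points P)"
    and \<alpha>: "smooth_map (prod_manifold M N) P \<alpha>" and \<beta>: "smooth_map P (prod_manifold M N) \<beta>"
    using assms(5) by (simp_all add: diffeomorphism_def \<beta>_def pts)
  have \<beta>\<alpha>: "\<beta> (\<alpha> (x, q)) = (x, q)" if "x \<in> points M" "q \<in> points N" for x q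
    using bij that by (simp add: \<beta>_def pts bij_betw_def)
  then have G\<alpha>: "G (\<alpha> (x, q)) = x" and F\<alpha>: "F (\<alpha> (x, q)) = q" if "x \<in> points M" "q \<in> points N" for x q
    using that by (simp_all add: G_def F_def)
  have \<alpha>\<beta>: "\<alpha> (G p, F p) = p" "G p \<in> points M" "F p \<in> points N" if "p \<in> points P" for p
  proof -
    have "p \<in> \<alpha> ` (points M \<times> points N)" using bij that by (simp add: bij_betw_def)
    then have "\<alpha> (\<beta> p) = p" "\<beta> p \<in> points M \<times> points N"
      unfolding \<beta>_def pts by (rule f_inv_into_f, rule inv_into_into)
    then show "\<alpha> (G p, F p) = p" "G p \<in> points M" "F p \<in> points N"
      by (simp_all add: G_def F_def mem_Times_iff)
  qed
  have G: "smooth_map P M G"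
    using smooth_map_compose[OF P' MN' chart_domain_openin[OF M'] \<beta> smooth_map_fst[OF M N]]
    by (simp add: G_def[abs_def])
  have F: "smooth_map P N F"
    using smooth_map_compose[OF P' MN' chart_domain_openin[OF N'] \<beta> smooth_map_snd[OF M N]]
    by (simp add: F_def[abs_def])
  have \<alpha>q: "smooth_map M P (\<lambda>x. \<alpha> (x, q))" if "q \<in> points N" for q
    using smooth_map_compose[OF M' MN' chart_domain_openin[OF P'] smooth_map_slice[OF M N that] \<alpha>] .
  have "is_complete_slicing P Z M N \<alpha> \<longleftrightarrow> annihilates P Z N F"
  proof
    assume "is_complete_slicing P Z M N \<alpha>"
    then obtain X where "\<forall>q\<in>points N. slicing P Z M (\<lambda>x. \<alpha> (x, q)) (\<lambda>x. X (x, q))"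
      by (auto simp: is_complete_slicing_def complete_slicing_def)
    then have X: "vector_field M (\<lambda>x. X (x, q))"
      "x \<in> points M \<Longrightarrow> tangent_map M P (\<lambda>x. \<alpha> (x, q)) (X (x, q)) = Z (\<alpha> (x, q))"
      if "q \<in> points N" for x q
      using that by (auto simp: slicing_def)
    show "annihilates P Z N F"
      unfolding annihilates_def
    proof (intro ballI)
      fix p c d assume p: "p \<in> points P" and c: "c \<in> charts_at P p" and d: "d \<in> charts_at N (F p)"
      define x where "x = G p"
      define q where "q = F p"
      have xq: "x \<in> points M" "q \<in> points N" "\<alpha> (x, q) = p"
        using \<alpha>\<beta>[OF p] by (simp_all add: x_def q_def)
      let ?\<alpha>q = "\<lambda>x. \<alpha> (x, q)"
      obtain e where e: "e \<in> charts_at M x" using chart_exists[OF M' xq(1)] by blast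
      have v: "X (x, q) \<in> tangent_space M x"
        using vector_field_tangent_space[OF X(1)[OF xq(2)] xq(1)] .
      have c': "c \<in> charts_at P (?\<alpha>q x)" and d': "d \<in> charts_at N (F (?\<alpha>q x))"
        using c d xq(3) by simp_all
      have "rep_deriv c d F p (snd (Z p) c) = rep_deriv c d F p (rep_deriv e c ?\<alpha>q x (snd (X (x, q)) e))"
        using snd_tangent_map[OF M P' \<alpha>q[OF xq(2)] v e c'] X(2)[OF xq(2,1)] xq(3) by simp
      also have "\<dots> = rep_deriv e d (\<lambda>x. F (?\<alpha>q x)) x (snd (X (x, q)) e)"
        using rep_deriv_compose[OF M' P' \<alpha>q[OF xq(2)] F e c' d'] xq(3) by simp
      \<comment> \<open>F is constantly \<open>q\<close> on the slice, so the constant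
        \<open>snd d q\<close> is its coordinate formula on the whole chart
        \<open>e\<close>.\<close>
      also have "rep_deriv e d (\<lambda>x. F (?\<alpha>q x)) x = (\<lambda>v. 0)"
      proof (rule rep_deriv_eqI[OF M' M' smooth_map_id[OF M] e e])
        have "e \<in> atlas M" using e by (simp add: charts_at_def)
        then show "snd d q = snd d (F (?\<alpha>q x))" if "x \<in> fst e" for x
          using F\<alpha>[OF _ xq(2), of x] chart_domain_subset[OF M', of e] that by auto
      qed simp
      finally show "rep_deriv c d F p (snd (Z p) c) = 0" .
    qed
  next
    assume ann: "annihilates P Z N F"
    define X where "X = (\<lambda>z. tangent_map P M G (Z (\<alpha> z)))"
    have fst_Z: "fst (Z p) = p" if "p \<in> points P" for p using Z that by (simp add: vector_field_def)
    have \<alpha>_pts: "\<alpha> (x, q) \<in> points P" if "x \<in> points M" "q \<in> points N" for x q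
      using smooth_map_points[OF \<alpha>q[OF that(2)] that(1)] .
    have fst_X: "fst (X (x, q)) = x" if "x \<in> points M" "q \<in> points N" for x q
      using that by (simp add: X_def fst_Z \<alpha>_pts G\<alpha>)
    have slice: "tangent_map M P (\<lambda>x. \<alpha> (x, q)) (X (x, q)) = Z (\<alpha> (x, q))"
      if x: "x \<in> points M" and q: "q \<in> points N" for x q
    proof -
      define p where "p = \<alpha> (x, q)"
      let ?\<alpha>q = "\<lambda>x. \<alpha> (x, q)"
      have p: "p \<in> points P" and Gp: "G p = x" and Fp: "F p = q"
        using \<alpha>_pts[OF x q] G\<alpha>[OF x q] F\<alpha>[OF x q] by (simp_all add: p_def)
      have Zp: "Z p \<in> tangent_space P p" using vector_field_tangent_space[OF Z p] .
      have Xp: "X (x, q) \<in> tangent_space M x"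
        using tangent_map_in_tangent_space[OF P M G p Zp] by (simp add: X_def Gp flip: p_def)
      obtain c where c: "c \<in> charts_at P p" using chart_exists[OF P' p] by blast
      obtain e where e: "e \<in> charts_at M x" using chart_exists[OF M' x] by blast
      obtain d where d: "d \<in> charts_at N q" using chart_exists[OF N' q] by blast
      note c' = charts_atD[OF c] and e' = charts_atD[OF e] and d' = charts_atD[OF d]
      \<comment> \<open>A product chart makes the coordinate expression of alpha a function of two
        separate arguments, as both partial derivatives are needed.\<close>
      define k where "k = (fst e \<times> fst d, map_prod (snd e) (snd d))"
      have k': "k \<in> atlas (prod_manifold M N)"
        unfolding prod_manifold_def manifold.simps k_def using e' d' by blast
      then have k: "k \<in> charts_at (prod_manifold M N) (x, q)"
        using e' d' by (auto simp: charts_at_def k_def)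
      let ?v = "snd (Z p) c"
      have D\<alpha>: "(local_rep k c \<alpha> has_derivative rep_deriv k c \<alpha> (x, q)) (at (snd e x, snd d q))"
        using local_rep_has_derivative[OF \<alpha> k, of c] c by (simp add: p_def k_def)
      have DG: "(local_rep c e G has_derivative rep_deriv c e G p) (at (snd c p))"
        using local_rep_has_derivative[OF G c] e Gp by simp
      have DF: "(local_rep c d F has_derivative rep_deriv c d F p) (at (snd c p))"
        using local_rep_has_derivative[OF F c] d Fp by simp
      have k_rep: "local_rep k c \<alpha> (snd e y, snd d z) = snd c (\<alpha> (y, z))"
        if "y \<in> fst e" "z \<in> fst d" for y z
        using local_rep_chart[OF MN' k', of "(y, z)"] that by (simp add: k_def)
      \<comment> \<open>The derivative of alpha_q is the partial derivative of alpha along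
        M.\<close>
      have slice_deriv: "rep_deriv e c ?\<alpha>q x = (\<lambda>w. rep_deriv k c \<alpha> (x, q) (w, 0))"
      proof (rule rep_deriv_eqI[OF M' M' smooth_map_id[OF M] e e])
        show "((\<lambda>y. local_rep k c \<alpha> (y, snd d q)) has_derivative (\<lambda>w. rep_deriv k c \<alpha> (x, q) (w, 0)))
            (at (snd e x))"
        proof -
          have "((\<lambda>y. (y, snd d q)) has_derivative (\<lambda>w. (w, 0))) (at (snd e x))"
            by (auto intro!: derivative_eq_intros)
          from has_derivative_compose[OF this, of "local_rep k c \<alpha>"] D\<alpha> show ?thesis by simp
        qed
        show "local_rep k c \<alpha> (snd e y, snd d q) = snd c (\<alpha> (y, q))" if "y \<in> fst e" for y
          using k_rep that d' by blast
      qed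
      \<comment> \<open>Differentiate \<open>\<alpha> \<circ> (G, F) = id\<close>.\<close>
      have "rep_deriv c c (\<lambda>x. x) p = (\<lambda>v. rep_deriv k c \<alpha> (x, q) (rep_deriv c e G p v, rep_deriv c d F p v))"
      \<comment> \<open>The map \<open>\<beta>\<close> with the chart \<open>k\<close> restricts to
        points where G and F both lie in their charts, so that all three local representatives are
        meaningful.\<close>
      proof (rule rep_deriv_eqI[OF P' MN' \<beta> c])
        show "k \<in> charts_at (prod_manifold M N) (\<beta> p)" using k \<beta>\<alpha>[OF x q] by (simp add: p_def)
        have "local_rep c e G (snd c p) = snd e x" "local_rep c d F (snd c p) = snd d q"
          using c' local_rep_chart[OF P', of c p e G] local_rep_chart[OF P', of c p d F] by (simp_all add: Gp Fp)
        then show "((\<lambda>u. local_rep k c \<alpha> (local_rep c e G u, local_rep c d F u)) has_derivative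
            (\<lambda>v. rep_deriv k c \<alpha> (x, q) (rep_deriv c e G p v, rep_deriv c d F p v))) (at (snd c p))"
          using has_derivative_compose[OF has_derivative_Pair[OF DG DF], of "local_rep k c \<alpha>"] D\<alpha> by simp
        fix y assume y: "y \<in> fst c" "\<beta> y \<in> fst k"
        then have "G y \<in> fst e" "F y \<in> fst d" by (simp_all add: k_def G_def F_def mem_Times_iff)
        moreover have "y \<in> points P" using y(1) c' chart_domain_subset[OF P', of c] by blast
        ultimately show "local_rep k c \<alpha> (local_rep c e G (snd c y), local_rep c d F (snd c y)) = snd c y"
          using c' y(1) local_rep_chart[OF P', of c y e G] local_rep_chart[OF P', of c y d F]
          by (simp add: k_rep \<alpha>\<beta>(1))
      qed
      \<comment> \<open>The derivative of the identity in \<open>c\<close> fixes \<open>?v\<close>: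
        this is compatibility of the tangent vector with the chart \<open>c\<close> taken
        twice.\<close>
      then have "?v = rep_deriv k c \<alpha> (x, q) (rep_deriv c e G p ?v, rep_deriv c d F p ?v)"
        using tangent_spaceD(2)[OF Zp c c] by metis
      \<comment> \<open>Here TF o Z = 0 removes the component along N, so the vector is reached from
        the slice alone.\<close>
      also have "rep_deriv c d F p ?v = 0" using ann p c d Fp by (simp add: annihilates_def)
      also have "rep_deriv k c \<alpha> (x, q) (rep_deriv c e G p ?v, 0) = rep_deriv e c ?\<alpha>q x (rep_deriv c e G p ?v)"
        by (simp add: slice_deriv)
      also have "rep_deriv c e G p ?v = snd (X (x, q)) e"
        using snd_tangent_map[OF P M' G Zp c, of e] e by (simp add: X_def Gp flip: p_def)
      also have "rep_deriv e c ?\<alpha>q x \<dots> = snd (tangent_map M P ?\<alpha>q (X (x, q))) c"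
        using snd_tangent_map[OF M P' \<alpha>q[OF q] Xp e, of c] c by (simp add: p_def)
      finally have "snd (tangent_map M P ?\<alpha>q (X (x, q))) c = ?v" ..
      moreover have "tangent_map M P ?\<alpha>q (X (x, q)) \<in> tangent_space P p"
        using tangent_map_in_tangent_space[OF M P \<alpha>q[OF q] x Xp] by (simp add: p_def)
      ultimately show ?thesis using tangent_space_eqI[OF _ Zp c] by (simp add: p_def)
    qed
    have "complete_slicing P Z M N \<alpha> X"
      unfolding complete_slicing_def pts
    proof (intro conjI ballI)
      show "smooth_map (prod_manifold M N) P \<alpha>" by (rule \<alpha>)
      show "smooth_map (prod_manifold M N) (tangent_bundle M) X"
        unfolding X_def by (rule smooth_map_tangent_map_field[OF MN' P M \<alpha> Z G])
      show "case z of (x, q) \<Rightarrow> fst (X (x, q)) = x" if "z \<in> points M \<times> points N" for z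
        using that fst_X by auto
      show "\<alpha> ` (points M \<times> points N) = points P \<or> openin (mtop P) (\<alpha> ` (points M \<times> points N)) \<and>
          mtop P closure_of \<alpha> ` (points M \<times> points N) = points P"
        using bij by (simp add: bij_betw_def)
      fix q assume q: "q \<in> points N"
      \<comment> \<open>Smoothness on the slice is obtained from the same lemma as on the product,
        with alpha_q in place of alpha.\<close>
      have "smooth_map M (tangent_bundle M) (\<lambda>x. X (x, q))"
        unfolding X_def by (rule smooth_map_tangent_map_field[OF M' P M \<alpha>q[OF q] Z G])
      then show "slicing P Z M (\<lambda>x. \<alpha> (x, q)) (\<lambda>x. X (x, q))"
        using \<alpha>q[OF q] fst_X[OF _ q] slice[OF _ q] by (simp add: slicing_def vector_field_def)
    qed
    then show "is_complete_slicing P Z M N \<alpha>" unfolding is_complete_slicing_def by blast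
  qed
  also have "\<dots> \<longleftrightarrow> constant_of_motion P Z N F"
    using constant_of_motion_iff_annihilates[OF P N Z F] by simp
  also have "F = snd \<circ> inv_into (points (prod_manifold M N)) \<alpha>"
    by (simp add: fun_eq_iff F_def \<beta>_def)
  finally show ?thesis .
qed

end
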